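(* Let $M^{n}$, $n\geq 3$, be an $n$-dimensional submanifold of an $m$-dimensional conformally flat Riemannian manifold $(\widetilde{M}^{m},\widetilde{g})$, $m\geq 4$. If at a point $x\in M^n$ $$\rho +\rho^{\perp}>\frac{2}{n(m-2)}\sum_{j=1}^{n}\widetilde{\operatorname{Ric}}(e_{j},e_{j})-\frac{2\widetilde{\tau}}{(m-1)(m-2)},$$ where $\{e_j\}_{1\le j\le n}$ is an orthonormal frame of the tangent space of $M^n$, then $M^{n}$ is not minimal at $x$.
   Context: $g$ is the metric induced on $M^n$ by $\widetilde g$; $h$ is the second fundamental form and $H=\frac1n\operatorname{trace} h$ the mean curvature vector; $M^n$ is minimal at $x$ if $H=0$ at $x$. $\widetilde{\operatorname{Ric}}$ is the Ricci tensor of $(\widetilde M^m,\widetilde g)$ and $\widetilde\tau$ is its scalar curvature normalized so that $2\widetilde\tau=\operatorname{trace}_{\widetilde g}\widetilde{\operatorname{Ric}}$. The normalized scalar curvature of $M^n$ is $\rho=\frac{2}{n(n-1)}\sum_{1\le i<j\le n}\sigma(e_i\wedge e_j)$, where $\sigma$ is the sectional curvature of $(M^n,g)$. The normalized normal scalar curvature is $\rho^\perp=\frac{2}{n(n-1)}\sqrt{\sum_{1\le i<j\le n}\sum_{1\le r<s\le m-n}\left(R^\perp(e_i,e_j,\upsilon_r,\upsilon_s)\right)^2}$, where $R^\perp$ is the curvature tensor of the normal connection and $\{\upsilon_r\}_{1\le r\le m-n}$ is a local orthonormal normal frame. For $m\ge4$, conformally flat is equivalent to vanishing of the Weyl tensor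 of $\widetilde g$. *)

theory Defs
  imports "HOL-Analysis.Analysis"
begin

section \<open>Smooth maps between open subsets of Euclidean spaces\<close>

(* Only meaningful for open S: derivatives are taken in the full neighbourhood of a point. *)
primrec Ck_on :: "nat \<Rightarrow> ('a::euclidean_space \<Rightarrow> 'b::real_normed_vector) \<Rightarrow> 'a set \<Rightarrow> bool" where
  "Ck_on 0 f S \<longleftrightarrow> continuous_on S f"
| "Ck_on (Suc k) f S \<longleftrightarrow>
     (\<forall>x\<in>S. f differentiable (at x)) \<and> (\<forall>v. Ck_on k (\<lambda>x. frechet_derivative f (at x) v) S)"

definition smooth_on :: "'a set \<Rightarrow> ('a::euclidean_space \<Rightarrow> 'b::real_normed_vector) \<Rightarrow> bool" where
  "smooth_on S f \<longleftrightarrow> (\<forall>k. Ck_on k f S)"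

section \<open>Riemannian geometry in one coordinate domain\<close>

text \<open>A metric in coordinates is a matrix field \<open>g\<close>. Tangent vectors at a point are vectors of
  \<open>real ^ 'k\<close>, and a constant vector also stands for the vector field with constant components;
  the Lie bracket of two such fields vanishes. The curvatures and the second fundamental form below
  are tensorial, so computing them with constant extensions of vectors loses nothing.\<close>

type_synonym 'k metric = "real ^ 'k \<Rightarrow> real ^ 'k ^ 'k"

definition ip :: "real ^ 'k ^ 'k \<Rightarrow> real ^ 'k \<Rightarrow> real ^ 'k \<Rightarrow> real" where
  "ip A v w = v \<bullet> (A *v w)"

definition orthonormal_family :: "real ^ 'k ^ 'k \<Rightarrow> nat \<Rightarrow> (nat \<Rightarrow> real ^ 'k) \<Rightarrow> bool" where
  "orthonormal_family A r e \<longleftrightarrow>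
     (\<forall>i\<in>{1..r}. \<forall>j\<in>{1..r}. ip A (e i) (e j) = (if i = j then 1 else 0))"

text \<open>Trace of a bilinear form with respect to the inner product with Gram matrix \<open>A\<close>.\<close>

definition metric_trace ::
  "real ^ 'k ^ 'k \<Rightarrow> (real ^ 'k \<Rightarrow> real ^ 'k \<Rightarrow> 'b::real_vector) \<Rightarrow> 'b" where
  "metric_trace A B =
     (\<Sum>i\<in>UNIV. \<Sum>j\<in>UNIV. (matrix_inv A $ i $ j) *\<^sub>R B (axis i 1) (axis j 1))"

text \<open>The vector \<open>\<nabla>\<^sub>v w\<close> of the Levi-Civita connection for constant \<open>v\<close>, \<open>w\<close>, from the
  Koszul formula.\<close>

definition christoffel :: "'k metric \<Rightarrow> real ^ 'k \<Rightarrow> real ^ 'k \<Rightarrow> real ^ 'k \<Rightarrow> real ^ 'k" where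
  "christoffel g y v w = matrix_inv (g y) *v
     (\<chi> l. (frechet_derivative (\<lambda>z. ip (g z) w (axis l 1)) (at y) v
          + frechet_derivative (\<lambda>z. ip (g z) v (axis l 1)) (at y) w
          - frechet_derivative (\<lambda>z. ip (g z) v w) (at y) (axis l 1)) / 2)"

text \<open>\<open>R(u,v)w = \<nabla>\<^sub>u \<nabla>\<^sub>v w - \<nabla>\<^sub>v \<nabla>\<^sub>u w\<close> for constant \<open>u\<close>, \<open>v\<close>, \<open>w\<close>.\<close>

definition curvature ::
  "'k metric \<Rightarrow> real ^ 'k \<Rightarrow> real ^ 'k \<Rightarrow> real ^ 'k \<Rightarrow> real ^ 'k \<Rightarrow> real ^ 'k" where
  "curvature g y u v w =
       frechet_derivative (\<lambda>z. christoffel g z v w) (at y) u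
         + christoffel g y u (christoffel g y v w)
     - (frechet_derivative (\<lambda>z. christoffel g z u w) (at y) v
         + christoffel g y v (christoffel g y u w))"

definition sectional_curvature :: "'k metric \<Rightarrow> real ^ 'k \<Rightarrow> real ^ 'k \<Rightarrow> real ^ 'k \<Rightarrow> real" where
  "sectional_curvature g y u v = ip (g y) (curvature g y u v v) u
     / (ip (g y) u u * ip (g y) v v - (ip (g y) u v)\<^sup>2)"

text \<open>The trace of \<open>u \<mapsto> R(u,v)w\<close>.\<close>

definition ricci :: "'k metric \<Rightarrow> real ^ 'k \<Rightarrow> real ^ 'k \<Rightarrow> real ^ 'k \<Rightarrow> real" where
  "ricci g y v w = (\<Sum>i\<in>UNIV. curvature g y (axis i 1) v w $ i)"

definition half_scalar_curvature :: "'k metric \<Rightarrow> real ^ 'k \<Rightarrow> real" where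
  "half_scalar_curvature g y = metric_trace (g y) (ricci g y) / 2"

definition normalized_scalar_curvature ::
  "'k metric \<Rightarrow> real ^ 'k \<Rightarrow> (nat \<Rightarrow> real ^ 'k) \<Rightarrow> real" where
  "normalized_scalar_curvature g y e =
     2 / (real CARD('k) * (real CARD('k) - 1)) *
     (\<Sum>i\<in>{1..CARD('k)}. \<Sum>j\<in>{i<..CARD('k)}. sectional_curvature g y (e i) (e j))"

section \<open>Submanifold geometry in coordinates\<close>

text \<open>\<open>G\<close> is the ambient metric and \<open>F\<close> the immersion, both in coordinates. Vector fields along \<open>F\<close>
  are functions \<open>real ^ 'n \<Rightarrow> real ^ 'm\<close>.\<close>

definition induced_metric :: "'m metric \<Rightarrow> (real ^ 'n \<Rightarrow> real ^ 'm) \<Rightarrow> 'n metric" where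
  "induced_metric G F y =
     (\<chi> i j. ip (G (F y)) (frechet_derivative F (at y) (axis i 1))
                         (frechet_derivative F (at y) (axis j 1)))"

text \<open>Subtracts the orthogonal projection to the tangent space, which is
  \<open>\<Sum> g\<^sup>i\<^sup>j \<langle>w, \<partial>\<^sub>i F\<rangle> \<partial>\<^sub>j F\<close> with \<open>g\<close> the induced metric.\<close>

definition normal_part ::
  "'m metric \<Rightarrow> (real ^ 'n \<Rightarrow> real ^ 'm) \<Rightarrow> real ^ 'n \<Rightarrow> real ^ 'm \<Rightarrow> real ^ 'm" where
  "normal_part G F y w = w - metric_trace (induced_metric G F y)
     (\<lambda>a b. ip (G (F y)) w (frechet_derivative F (at y) a) *\<^sub>R frechet_derivative F (at y) b)"

text \<open>Ambient Levi-Civita connection, pulled back to vector fields \<open>W\<close> along \<open>F\<close>.\<close>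

definition cov_along ::
  "'m metric \<Rightarrow> (real ^ 'n \<Rightarrow> real ^ 'm) \<Rightarrow> real ^ 'n \<Rightarrow> (real ^ 'n \<Rightarrow> real ^ 'm)
     \<Rightarrow> real ^ 'n \<Rightarrow> real ^ 'm" where
  "cov_along G F v W y = frechet_derivative W (at y) v
     + christoffel G (F y) (frechet_derivative F (at y) v) (W y)"

text \<open>\<open>h(v,w)\<close> is the normal part of the ambient derivative of the tangent field
  \<open>z \<mapsto> dF\<^sub>z(w)\<close> in direction \<open>v\<close>.\<close>

definition second_fundamental_form ::
  "'m metric \<Rightarrow> (real ^ 'n \<Rightarrow> real ^ 'm) \<Rightarrow> real ^ 'n \<Rightarrow> real ^ 'n \<Rightarrow> real ^ 'n \<Rightarrow> real ^ 'm" where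
  "second_fundamental_form G F y v w =
     normal_part G F y (cov_along G F v (\<lambda>z. frechet_derivative F (at z) w) y)"

definition mean_curvature ::
  "'m metric \<Rightarrow> (real ^ 'n \<Rightarrow> real ^ 'm) \<Rightarrow> real ^ 'n \<Rightarrow> real ^ 'm" where
  "mean_curvature G F y = (1 / real CARD('n)) *\<^sub>R
     metric_trace (induced_metric G F y) (second_fundamental_form G F y)"

definition minimal_at :: "'m metric \<Rightarrow> (real ^ 'n \<Rightarrow> real ^ 'm) \<Rightarrow> real ^ 'n \<Rightarrow> bool" where
  "minimal_at G F y \<longleftrightarrow> mean_curvature G F y = 0"

definition normal_connection ::
  "'m metric \<Rightarrow> (real ^ 'n \<Rightarrow> real ^ 'm) \<Rightarrow> real ^ 'n \<Rightarrow> (real ^ 'n \<Rightarrow> real ^ 'm)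
     \<Rightarrow> real ^ 'n \<Rightarrow> real ^ 'm" where
  "normal_connection G F v \<xi> y = normal_part G F y (cov_along G F v \<xi> y)"

text \<open>\<open>\<langle>R\<^sup>\<bottom>(u,v)\<xi>, \<eta>\<rangle>\<close> at \<open>y\<close>, for normal fields \<open>\<xi>\<close>, \<open>\<eta>\<close> near \<open>y\<close> and constant \<open>u\<close>, \<open>v\<close>.\<close>

definition normal_curvature ::
  "'m metric \<Rightarrow> (real ^ 'n \<Rightarrow> real ^ 'm) \<Rightarrow> real ^ 'n \<Rightarrow> real ^ 'n \<Rightarrow> real ^ 'n
     \<Rightarrow> (real ^ 'n \<Rightarrow> real ^ 'm) \<Rightarrow> (real ^ 'n \<Rightarrow> real ^ 'm) \<Rightarrow> real" where
  "normal_curvature G F y u v \<xi> \<eta> = ip (G (F y))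
     (normal_connection G F u (normal_connection G F v \<xi>) y
      - normal_connection G F v (normal_connection G F u \<xi>) y) (\<eta> y)"

definition local_normal_frame ::
  "(real ^ 'n) set \<Rightarrow> 'm metric \<Rightarrow> (real ^ 'n \<Rightarrow> real ^ 'm) \<Rightarrow> real ^ 'n
     \<Rightarrow> (nat \<Rightarrow> real ^ 'n \<Rightarrow> real ^ 'm) \<Rightarrow> bool" where
  "local_normal_frame D G F y \<upsilon> \<longleftrightarrow>
     (\<exists>W. open W \<and> y \<in> W \<and> W \<subseteq> D \<and>
       (\<forall>r\<in>{1..CARD('m) - CARD('n)}. smooth_on W (\<upsilon> r)) \<and>
       (\<forall>z\<in>W. orthonormal_family (G (F z)) (CARD('m) - CARD('n)) (\<lambda>r. \<upsilon> r z) \<and>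
          (\<forall>r\<in>{1..CARD('m) - CARD('n)}. \<forall>v.
             ip (G (F z)) (\<upsilon> r z) (frechet_derivative F (at z) v) = 0)))"

definition normalized_normal_scalar_curvature ::
  "'m metric \<Rightarrow> (real ^ 'n \<Rightarrow> real ^ 'm) \<Rightarrow> real ^ 'n \<Rightarrow> (nat \<Rightarrow> real ^ 'n)
     \<Rightarrow> (nat \<Rightarrow> real ^ 'n \<Rightarrow> real ^ 'm) \<Rightarrow> real" where
  "normalized_normal_scalar_curvature G F y e \<upsilon> =
     2 / (real CARD('n) * (real CARD('n) - 1)) *
     sqrt (\<Sum>i\<in>{1..CARD('n)}. \<Sum>j\<in>{i<..CARD('n)}.
           \<Sum>r\<in>{1..CARD('m) - CARD('n)}. \<Sum>s\<in>{r<..CARD('m) - CARD('n)}.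
             (normal_curvature G F y (e i) (e j) (\<upsilon> r) (\<upsilon> s))\<^sup>2)"

section \<open>Manifolds, Riemannian metrics and immersions\<close>

text \<open>A chart is a pair of its domain and its coordinate map. A manifold is given by a smooth
  atlas (not necessarily maximal), and its points are those covered by the atlas.\<close>

type_synonym ('p, 'k) chart = "'p set \<times> ('p \<Rightarrow> real ^ 'k)"

definition chart_inv :: "('p, 'k::finite) chart \<Rightarrow> real ^ 'k \<Rightarrow> 'p" where
  "chart_inv c = inv_into (fst c) (snd c)"

definition is_chart :: "('p::topological_space, 'k::finite) chart \<Rightarrow> bool" where
  "is_chart c \<longleftrightarrow> open (fst c) \<and> open (snd c ` fst c) \<and>
     homeomorphism (fst c) (snd c ` fst c) (snd c) (chart_inv c)"

definition smooth_atlas ::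
  "('p::{t2_space, second_countable_topology}, 'k::finite) chart set \<Rightarrow> bool" where
  "smooth_atlas A \<longleftrightarrow> (\<forall>c\<in>A. is_chart c) \<and>
     (\<forall>c\<in>A. \<forall>d\<in>A. smooth_on (snd c ` (fst c \<inter> fst d)) (snd d \<circ> chart_inv c))"

definition points :: "('p, 'k::finite) chart set \<Rightarrow> 'p set" where
  "points A = (\<Union>c\<in>A. fst c)"

text \<open>A metric is given by its component matrices in the charts, subject to the transformation law
  of covariant 2-tensors.\<close>

definition riemannian_metric ::
  "('p, 'k::finite) chart set \<Rightarrow> (('p, 'k) chart \<Rightarrow> 'k metric) \<Rightarrow> bool" where
  "riemannian_metric A g \<longleftrightarrow>
     (\<forall>c\<in>A. smooth_on (snd c ` fst c) (g c) \<and>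
        (\<forall>y\<in>snd c ` fst c. transpose (g c y) = g c y \<and> (\<forall>v. v \<noteq> 0 \<longrightarrow> ip (g c y) v v > 0))) \<and>
     (\<forall>c\<in>A. \<forall>d\<in>A. \<forall>y\<in>snd c ` (fst c \<inter> fst d). \<forall>v w.
        (let T = snd d \<circ> chart_inv c
         in ip (g c y) v w =
            ip (g d (T y)) (frechet_derivative T (at y) v) (frechet_derivative T (at y) w)))"

text \<open>Each point has a neighbourhood \<open>U\<close> on which some conformal metric \<open>e\<^sup>2\<^sup>u g\<close> is flat.\<close>

definition conformally_flat ::
  "('p::topological_space, 'k::finite) chart set \<Rightarrow> (('p, 'k) chart \<Rightarrow> 'k metric) \<Rightarrow> bool" where
  "conformally_flat A g \<longleftrightarrow>
     (\<forall>p\<in>points A. \<exists>U u. open U \<and> p \<in> U \<and> U \<subseteq> points A \<and>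
        (\<forall>c\<in>A. smooth_on (snd c ` (fst c \<inter> U)) (u \<circ> chart_inv c) \<and>
           (\<forall>y\<in>snd c ` (fst c \<inter> U). \<forall>v w z.
              curvature (\<lambda>y. exp (2 * u (chart_inv c y)) *\<^sub>R g c y) y v w z = 0)))"

definition coord_rep ::
  "('p, 'n::finite) chart \<Rightarrow> ('q, 'm::finite) chart \<Rightarrow> ('p \<Rightarrow> 'q) \<Rightarrow> real ^ 'n \<Rightarrow> real ^ 'm" where
  "coord_rep c d f = snd d \<circ> f \<circ> chart_inv c"

definition coord_dom ::
  "('p, 'n::finite) chart \<Rightarrow> ('q, 'm::finite) chart \<Rightarrow> ('p \<Rightarrow> 'q) \<Rightarrow> (real ^ 'n) set" where
  "coord_dom c d f = snd c ` (fst c \<inter> f -` fst d)"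

definition immersion ::
  "('p::topological_space, 'n::finite) chart set \<Rightarrow> ('q::topological_space, 'm::finite) chart set
     \<Rightarrow> ('p \<Rightarrow> 'q) \<Rightarrow> bool" where
  "immersion A B f \<longleftrightarrow> f ` points A \<subseteq> points B \<and> continuous_on (points A) f \<and>
     (\<forall>c\<in>A. \<forall>d\<in>B. smooth_on (coord_dom c d f) (coord_rep c d f) \<and>
        (\<forall>y\<in>coord_dom c d f. inj (frechet_derivative (coord_rep c d f) (at y))))"

end

theory Submission
  imports Defs
begin

text \<open>Suppose \<open>M\<close> is minimal at \<open>x\<close>. The curvature of a conformally flat metric is determined by a
  symmetric endomorphism \<open>S\<close>, as \<open>R(u,v)w = \<langle>Sv,w\<rangle>u - \<langle>Su,w\<rangle>v + \<langle>v,w\<rangle>Su - \<langle>u,w\<rangle>Sv\<close>, and the right-hand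
  side of the hypothesis is the average of the ambient curvatures of the planes \<open>e\<^sub>i \<and> e\<^sub>j\<close>. Let \<open>A\<^sub>r\<close>
  be the shape operators of a normal frame. By the Gauss equation and minimality \<open>\<rho>\<close> is this
  average minus \<open>\<Sum>\<^sub>r \<bar>A\<^sub>r\<bar>\<^sup>2 / (n(n-1))\<close>. By the Ricci equation, whose ambient term vanishes,
  \<open>\<rho>\<^sup>\<bottom>\<close> is \<open>(\<Sum>\<^sub>r\<^sub>s \<bar>[A\<^sub>r,A\<^sub>s]\<bar>\<^sup>2)\<^sup>1\<^sup>/\<^sup>2 / (n(n-1))\<close>. So the hypothesis contradicts the
  inequality \<open>\<Sum>\<^sub>r\<^sub>s \<bar>[A\<^sub>r,A\<^sub>s]\<bar>\<^sup>2 \<le> (\<Sum>\<^sub>r \<bar>A\<^sub>r\<bar>\<^sup>2)\<^sup>2\<close> for symmetric matrices (the DDVV conjecture).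
  For the latter one may take the \<open>A\<^sub>r\<close> to be multiples of orthonormal \<open>E\<^sub>r\<close>, and then
  it suffices that \<open>\<Sum>\<^sub>s \<bar>[E\<^sub>r,E\<^sub>s]\<bar>\<^sup>2\<close>, summed over any set of indices containing \<open>r\<close>, is at most the
  size of the set.\<close>

section \<open>Spectral theorem for self-adjoint maps\<close>

text \<open>A bound on single pairs cannot give the matrix inequality: for orthonormal symmetric X,
  Y the squared norm of [X,Y] can be 2, as for diag(1,-1)/sqrt 2 and its off-diagonal counterpart.
  What survives is a bound on row sums, in which the vanishing term [X,X] leaves a slack of 1. Since
  the weights of the E_r are nonnegative, row sums over all index sets suffice: peeling off the
  smallest weight reduces the quadratic form to a smaller set. That a slack of 1 is enough is a fact
  about eigenvalues: for a matrix of norm 1 all gaps above 1 share one eigenvector, and their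
  squares are controlled by the Laplacian of a star graph. On the geometric side, the Schouten
  endomorphism is built from the Hessian and the gradient of the conformal exponent. The equations
  of Gauss and Ricci come from differentiating inner products that see only the tangential or only
  the normal part of a field, so \<open>h\<close> itself is never differentiated.\<close>

lemma psd_kernel:
  fixes f :: "'a::euclidean_space \<Rightarrow> 'a"
  assumes lin: "linear f" and self: "\<And>x y. f x \<bullet> y = x \<bullet> f y"
    and S: "subspace S" and inv: "f ` S \<subseteq> S"
    and psd: "\<And>y. y \<in> S \<Longrightarrow> y \<bullet> f y \<ge> 0" and x: "x \<in> S" "x \<bullet> f x = 0"
  shows "f x = 0"
proof -
  \<comment> \<open>The form at \<open>x + t *\<^sub>R f x\<close> is nonnegative for all
    \<open>t\<close> and vanishes at \<open>t = 0\<close>, so its linear coefficient, twice the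
    squared norm of \<open>f x\<close>, must vanish.\<close>
  have q: "0 \<le> 2 * t * (f x \<bullet> f x) + t\<^sup>2 * (f x \<bullet> f (f x))" for t
  proof -
    have fx: "f x \<in> S" using inv x by auto
    have "x + t *\<^sub>R f x \<in> S" using S x(1) fx by (simp add: subspace_add subspace_scale)
    from psd[OF this] have "0 \<le> x \<bullet> f x + t * (x \<bullet> f (f x)) + t * (f x \<bullet> f x) + t * t * (f x \<bullet> f (f x))"
      by (simp add: linear_add[OF lin] linear_scale[OF lin] algebra_simps)
    moreover have "x \<bullet> f (f x) = f x \<bullet> f x" by (simp add: self)
    ultimately show ?thesis using x(2) by (simp add: power2_eq_square)
  qed
  have "f x \<bullet> f x = 0"
  proof (rule ccontr)
    assume n: "f x \<bullet> f x \<noteq> 0"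
    define a where "a = f x \<bullet> f x"
    define b where "b = f x \<bullet> f (f x)"
    have a: "a > 0" using n unfolding a_def by (simp add: order_less_le)
    have b: "b \<ge> 0" using psd[of "f x"] inv x unfolding b_def by auto
    \<comment> \<open>A small negative \<open>t\<close> makes the linear term win; the
      \<open>+ 1\<close> keeps the denominator positive when \<open>b = 0\<close>.\<close>
    define t where "t = - a / (b + 1)"
    have tb: "t * (b + 1) = - a" using b by (simp add: t_def)
    have t: "t < 0" using a b by (simp add: t_def divide_less_0_iff)
    have "0 \<le> t * (2 * a + t * b)" using q[of t] a_def b_def by (simp add: power2_eq_square algebra_simps)
    then have "2 * a + t * b \<le> 0" using t by (simp add: zero_le_mult_iff)
    then have "a \<le> t" using tb by (simp add: algebra_simps)
    then show False using a t by simp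
  qed
  then show ?thesis by simp
qed

text \<open>A maximiser \<open>x\<close> of the form on the compact unit sphere of \<open>S\<close>
  is an eigenvector: with \<open>l\<close> the maximum, \<open>l *\<^sub>R y - f y\<close> is
  positive semidefinite on \<open>S\<close> and its form vanishes at \<open>x\<close>, so
  \<open>psd_kernel\<close> applies.\<close>

lemma exists_eigenvector:
  fixes f :: "'a::euclidean_space \<Rightarrow> 'a"
  assumes lin: "linear f" and self: "\<And>x y. f x \<bullet> y = x \<bullet> f y"
    and S: "subspace S" and inv: "f ` S \<subseteq> S" and ne: "S \<noteq> {0}"
  obtains x l where "x \<in> S" "norm x = 1" "f x = l *\<^sub>R x"
proof -
  let ?K = "sphere 0 1 \<inter> S"
  obtain z where z: "z \<in> S" "z \<noteq> 0" using S ne subspace_0 by blast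
  have "z /\<^sub>R norm z \<in> ?K" using z S by (simp add: subspace_scale)
  then have "?K \<noteq> {}" by blast
  moreover have "compact ?K" by (intro compact_Int_closed closed_subspace S compact_sphere)
  moreover have "continuous_on ?K (\<lambda>x. x \<bullet> f x)"
    using lin linear_conv_bounded_linear linear_continuous_on
    by (intro continuous_on_inner continuous_on_id) blast
  ultimately obtain x where x: "x \<in> ?K" and mx: "\<And>y. y \<in> ?K \<Longrightarrow> y \<bullet> f y \<le> x \<bullet> f x"
    using continuous_attains_sup[of ?K "\<lambda>x. x \<bullet> f x"] by blast
  define l where "l = x \<bullet> f x"
  define g where "g = (\<lambda>y. l *\<^sub>R y - f y)"
  have "g x = 0"
  proof (rule psd_kernel[where S = S and f = g and x = x])
    show "linear g" unfolding g_def
      by (auto intro!: linearI simp: linear_add[OF lin] linear_scale[OF lin] algebra_simps)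
    show "g u \<bullet> v = u \<bullet> g v" for u v by (simp add: g_def algebra_simps self)
    show "g ` S \<subseteq> S" using S inv by (auto simp: g_def subspace_diff subspace_scale)
    show "x \<bullet> g x = 0" using x by (simp add: g_def algebra_simps l_def power2_norm_eq_inner[symmetric])
    show "y \<bullet> g y \<ge> 0" if "y \<in> S" for y
    proof (cases "y = 0")
      case True then show ?thesis by (simp add: g_def)
    next
      case False
      then have "y /\<^sub>R norm y \<in> ?K" using that S by (simp add: subspace_scale)
      from mx[OF this] have "(y \<bullet> f y) / (norm y)\<^sup>2 \<le> l"
        by (simp add: l_def linear_scale[OF lin] divide_inverse power2_eq_square mult_ac)
      then have "y \<bullet> f y \<le> l * (norm y)\<^sup>2" using False by (simp add: field_simps)
      then show ?thesis by (simp add: g_def algebra_simps power2_norm_eq_inner)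
    qed
  qed (use S x in auto)
  then show ?thesis using x that[of x l] by (auto simp: g_def)
qed

text \<open>Induction on the dimension: the complement of an eigenvector in \<open>S\<close> is
  again invariant because \<open>f\<close> is self-adjoint. The subspace \<open>S\<close> also lets
  the lemma run inside the symmetric matrices, where the eigenvectors of
  \<open>gram_diagonalization\<close> have to stay.\<close>

lemma spectral_basis:
  fixes f :: "'a::euclidean_space \<Rightarrow> 'a"
  assumes lin: "linear f" and self: "\<And>x y. f x \<bullet> y = x \<bullet> f y"
    and S: "subspace S" and inv: "f ` S \<subseteq> S"
  shows "\<exists>B l. finite B \<and> B \<subseteq> S \<and> span B = S \<and> pairwise orthogonal B \<and> (\<forall>b\<in>B. norm b = 1 \<and> f b = l b *\<^sub>R b)"
  using S inv
proof (induction "dim S" arbitrary: S rule: less_induct)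
  case less
  show ?case
  proof (cases "S = {0}")
    case True
    then show ?thesis by (intro exI[of _ "{}"]) auto
  next
    case False
    obtain x l0 where x: "x \<in> S" "norm x = 1" "f x = l0 *\<^sub>R x"
      using exists_eigenvector[OF lin self less.prems False] .
    define T where "T = S \<inter> {y. x \<bullet> y = 0}"
    have T: "subspace T" unfolding T_def by (rule subspace_inter[OF less.prems(1) subspace_hyperplane])
    have "f y \<in> T" if "y \<in> T" for y
    proof -
      have "x \<bullet> f y = f x \<bullet> y" by (simp add: self)
      then show ?thesis using that less.prems x by (auto simp: T_def)
    qed
    then have fT: "f ` T \<subseteq> T" by auto
    have "x \<notin> T" using x by (auto simp: T_def)
    then have "T \<subset> S" using x(1) unfolding T_def by blast
    then have "dim T < dim S"
      using T less.prems dim_psubset[of T S] by (simp add: span_eq_iff[THEN iffD2])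
    from less.hyps[OF this T fT] obtain B l where B: "finite B" "B \<subseteq> T" "span B = T" "pairwise orthogonal B"
      "\<forall>b\<in>B. norm b = 1 \<and> f b = l b *\<^sub>R b" by blast
    have xB: "x \<notin> B" using B(2) \<open>x \<notin> T\<close> by auto
    have orth: "x \<bullet> b = 0" if "b \<in> B" for b using that B(2) by (auto simp: T_def)
    have sp: "span (insert x B) = S"
    proof
      show "span (insert x B) \<subseteq> S"
        by (rule span_minimal) (use x B(2) T_def less.prems in auto)
      show "S \<subseteq> span (insert x B)"
      proof
        fix y assume y: "y \<in> S"
        have "y - (x \<bullet> y) *\<^sub>R x \<in> T" using y x less.prems
          by (auto simp: T_def subspace_diff subspace_scale inner_diff_right power2_norm_eq_inner[symmetric])
        then have "y - (x \<bullet> y) *\<^sub>R x \<in> span B" using B by simp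
        then show "y \<in> span (insert x B)"
          by (auto simp: span_insert)
      qed
    qed
    show ?thesis
    proof (intro exI conjI)
      show "span (insert x B) = S" by (rule sp)
      show "pairwise orthogonal (insert x B)"
        using B(4) orth by (auto simp: pairwise_insert orthogonal_def inner_commute)
      show "insert x B \<subseteq> S" using x B(2) by (auto simp: T_def)
      show "\<forall>b\<in>insert x B. norm b = 1 \<and> f b = (l(x := l0)) b *\<^sub>R b" using B(5) x xB by auto
    qed (use B in auto)
  qed
qed

section \<open>The inequality of Ge--Tang and Lu\<close>

lemma onb_parseval:
  fixes x y :: "'a::euclidean_space"
  assumes "finite B" "pairwise orthogonal B" "\<And>b. b \<in> B \<Longrightarrow> norm b = 1" "x \<in> span B"
  shows "x \<bullet> y = (\<Sum>b\<in>B. (x \<bullet> b) * (b \<bullet> y))"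
proof -
  have "x \<bullet> y = (\<Sum>b\<in>B. (x \<bullet> b) *\<^sub>R b) \<bullet> y"
    using orthonormal_basis_expand[of B x] assms by simp
  then show ?thesis by (simp add: inner_sum_left)
qed

lemma onb_inner:
  assumes "pairwise orthogonal B" "\<And>b. b \<in> B \<Longrightarrow> norm b = 1" "a \<in> B" "b \<in> B"
  shows "a \<bullet> b = (if a = b then 1 else 0)"
  using assms by (auto simp: pairwise_def orthogonal_def norm_eq_1)

text \<open>The projection \<open>p\<close> of \<open>x\<close> to the span of \<open>S\<close>
  satisfies \<open>p \<bullet> x = p \<bullet> p\<close>, so the squared norm of
  \<open>x - p\<close> is the gap in the inequality.\<close>

lemma bessel_inequality:
  fixes x :: "'a::euclidean_space"
  assumes S: "finite S" "pairwise orthogonal S" "\<And>b. b \<in> S \<Longrightarrow> norm b = 1"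
  shows "(\<Sum>b\<in>S. (b \<bullet> x)\<^sup>2) \<le> (norm x)\<^sup>2"
proof -
  define p where "p = (\<Sum>b\<in>S. (x \<bullet> b) *\<^sub>R b)"
  have "p \<in> span S" unfolding p_def by (intro span_sum span_scale span_base)
  have pb: "p \<bullet> b = x \<bullet> b" if "b \<in> S" for b
  proof -
    have "p \<bullet> b = (\<Sum>c\<in>S. (x \<bullet> c) * (if c = b then 1 else 0))"
      unfolding p_def inner_sum_left using that by (auto intro!: sum.cong simp: onb_inner[OF S(2,3)])
    also have "\<dots> = x \<bullet> b" using S(1) that by (simp add: if_distrib cong: if_cong)
    finally show ?thesis .
  qed
  have "p \<bullet> x = (\<Sum>b\<in>S. (b \<bullet> x)\<^sup>2)" unfolding p_def inner_sum_left inner_scaleR_left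
    by (intro sum.cong refl) (simp add: power2_eq_square inner_commute)
  moreover have "p \<bullet> p = (\<Sum>b\<in>S. (b \<bullet> x)\<^sup>2)"
  proof -
    have "p \<bullet> p = (\<Sum>b\<in>S. (p \<bullet> b) * (b \<bullet> p))"
      by (rule onb_parseval[OF S(1,2) _ \<open>p \<in> span S\<close>]) (rule S(3))
    also have "\<dots> = (\<Sum>b\<in>S. (b \<bullet> x)\<^sup>2)"
      by (intro sum.cong refl) (metis pb inner_commute power2_eq_square)
    finally show ?thesis .
  qed
  moreover have "0 \<le> (x - p) \<bullet> (x - p)" by simp
  ultimately show ?thesis
    by (simp add: inner_diff_left inner_diff_right inner_commute[of x p] power2_norm_eq_inner)
qed

text \<open>The diagonalisation \<open>\<Sum>\<^sub>r A\<^sub>r \<otimes> A\<^sub>r = \<Sum>\<^sub>b l\<^sub>b b \<otimes> b\<close> replaces a rotation of the family \<open>A\<close>.\<close>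
lemma gram_diagonalization:
  fixes A :: "'r \<Rightarrow> 'a::euclidean_space"
  assumes I: "finite I" and S: "subspace S" and A: "\<And>r. r \<in> I \<Longrightarrow> A r \<in> S"
  obtains B l where "finite B" "B \<subseteq> S" "pairwise orthogonal B" "\<And>b. b \<in> B \<Longrightarrow> norm b = 1"
    "\<And>b. b \<in> B \<Longrightarrow> 0 \<le> l b"
    "\<And>T :: 'a \<Rightarrow> 'c::real_inner. linear T \<Longrightarrow> (\<Sum>r\<in>I. (norm (T (A r)))\<^sup>2) = (\<Sum>b\<in>B. l b * (norm (T b))\<^sup>2)"
    "(\<Sum>r\<in>I. (norm (A r))\<^sup>2) = (\<Sum>b\<in>B. l b)"
proof -
  \<comment> \<open>The tensor sum read as an operator. It maps into \<open>S\<close>, so its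
    eigenbasis can be taken inside \<open>S\<close>.\<close>
  define L where "L = (\<lambda>x. \<Sum>r\<in>I. (A r \<bullet> x) *\<^sub>R A r)"
  have lin: "linear L" unfolding L_def
    by (auto intro!: linearI simp: inner_add_right scaleR_add_left sum.distrib scaleR_sum_right)
  have self: "L x \<bullet> y = x \<bullet> L y" for x y
    unfolding L_def by (simp add: inner_sum_left inner_sum_right mult.commute inner_commute[of x])
  have LS: "L ` S \<subseteq> S" unfolding L_def by (auto intro!: subspace_sum[OF S] subspace_scale[OF S] A)
  obtain B l where B: "finite B" "B \<subseteq> S" "span B = S" "pairwise orthogonal B"
      "\<And>b. b \<in> B \<Longrightarrow> norm b = 1" "\<And>b. b \<in> B \<Longrightarrow> L b = l b *\<^sub>R b"
    using spectral_basis[OF lin self S LS] by blast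
  \<comment> \<open>The coefficient vectors of the family in the basis \<open>B\<close> are
    orthogonal with squared lengths \<open>l\<close>, which is what a rotation of the family would
    achieve.\<close>
  have gram: "(\<Sum>r\<in>I. (A r \<bullet> a) * (A r \<bullet> b)) = (if a = b then l a else 0)" if "a \<in> B" "b \<in> B" for a b
  proof -
    have "(\<Sum>r\<in>I. (A r \<bullet> a) * (A r \<bullet> b)) = L a \<bullet> b" unfolding L_def by (simp add: inner_sum_left)
    also have "\<dots> = (if a = b then l a else 0)" using B that onb_inner[OF B(4,5)] by simp
    finally show ?thesis .
  qed
  have nonneg: "0 \<le> l b" if "b \<in> B" for b
    using gram[OF that that] sum_nonneg[of I "\<lambda>r. (A r \<bullet> b) * (A r \<bullet> b)"] by simp
  have ex: "A r = (\<Sum>b\<in>B. (A r \<bullet> b) *\<^sub>R b)" if "r \<in> I" for r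
    using orthonormal_basis_expand[of B "A r"] B A[OF that] by simp
  have T: "(\<Sum>r\<in>I. (norm (T (A r)))\<^sup>2) = (\<Sum>b\<in>B. l b * (norm (T b))\<^sup>2)" if "linear T"
    for T :: "'a \<Rightarrow> 'd::real_inner"
  proof -
    have TA: "T (A r) = (\<Sum>b\<in>B. (A r \<bullet> b) *\<^sub>R T b)" if "r \<in> I" for r
      by (subst ex[OF that]) (simp add: linear_sum[OF \<open>linear T\<close>] linear_scale[OF \<open>linear T\<close>])
    have "(\<Sum>r\<in>I. (norm (T (A r)))\<^sup>2) = (\<Sum>r\<in>I. \<Sum>a\<in>B. \<Sum>b\<in>B. (A r \<bullet> a) * (A r \<bullet> b) * (T a \<bullet> T b))"
      by (intro sum.cong refl) (simp add: TA power2_norm_eq_inner inner_sum_left inner_sum_right mult_ac sum_distrib_left inner_commute)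
    also have "\<dots> = (\<Sum>a\<in>B. \<Sum>b\<in>B. (\<Sum>r\<in>I. (A r \<bullet> a) * (A r \<bullet> b)) * (T a \<bullet> T b))"
      by (simp add: sum_distrib_right sum.swap[of _ I])
    also have "\<dots> = (\<Sum>a\<in>B. \<Sum>b\<in>B. if b = a then l a * (T a \<bullet> T a) else 0)"
      by (intro sum.cong refl) (simp add: gram)
    also have "\<dots> = (\<Sum>b\<in>B. l b * (norm (T b))\<^sup>2)"
      using B(1) by (simp add: power2_norm_eq_inner)
    finally show ?thesis .
  qed
  show ?thesis
  proof
    show "(\<Sum>r\<in>I. (norm (A r))\<^sup>2) = (\<Sum>b\<in>B. l b)"
      using T[of "\<lambda>x. x"] B(5) by (simp add: linear_ident)
  qed (use B nonneg T in auto)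
qed

text \<open>Split off the minimum \<open>m\<close> of \<open>x\<close>, so that \<open>x - m\<close> is supported on a smaller set.\<close>
lemma nonneg_form_if_row_sums_nonneg:
  fixes b :: "'i \<Rightarrow> 'i \<Rightarrow> real"
  assumes "finite I" and sym: "\<And>i j. b i j = b j i"
    and row: "\<And>S i. S \<subseteq> I \<Longrightarrow> i \<in> S \<Longrightarrow> 0 \<le> (\<Sum>j\<in>S. b i j)"
    and x: "\<And>i. i \<in> I \<Longrightarrow> 0 \<le> x i"
  shows "0 \<le> (\<Sum>i\<in>I. \<Sum>j\<in>I. b i j * (x i * x j))"
  using assms(1) row x
proof (induction "card I" arbitrary: I x)
  case 0 then show ?case by simp
next
  case (Suc k)
  then have ne: "I \<noteq> {}" by auto
  define m where "m = Min (x ` I)"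
  have mle: "m \<le> x i" if "i \<in> I" for i using Suc.prems that by (simp add: m_def)
  have "m \<in> x ` I" unfolding m_def using Suc.prems ne by (intro Min_in) auto
  then obtain i0 where i0: "i0 \<in> I" "x i0 = m" by auto
  define y where "y = (\<lambda>i. x i - m)"
  have m0: "0 \<le> m" using Suc.prems(3) i0 by auto
  define J where "J = I - {i0}"
  have IJ: "I = insert i0 J" "i0 \<notin> J" "finite J" using i0 Suc.prems by (auto simp: J_def)
  have "0 \<le> (\<Sum>i\<in>J. \<Sum>j\<in>J. b i j * (y i * y j))"
  proof (rule Suc.hyps(1))
    show "k = card J" using Suc.hyps(2) IJ by simp
    show "0 \<le> y i" if "i \<in> J" for i using that mle IJ by (auto simp: y_def)
    show "0 \<le> (\<Sum>j\<in>S. b i j)" if "S \<subseteq> J" "i \<in> S" for S i using Suc.prems(2)[of S i] that IJ by auto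
  qed (rule IJ)
  \<comment> \<open>Adding \<open>i0\<close> back changes nothing, since
    \<open>y i0 = 0\<close>.\<close>
  also have "\<dots> = (\<Sum>i\<in>I. \<Sum>j\<in>I. b i j * (y i * y j))"
    unfolding IJ(1) using IJ(2,3) i0 by (simp add: y_def)
  finally have 1: "0 \<le> (\<Sum>i\<in>I. \<Sum>j\<in>I. b i j * (y i * y j))" .
  have 2: "0 \<le> (\<Sum>i\<in>I. y i * (\<Sum>j\<in>I. b i j))"
    using mle Suc.prems(2)[of I] by (intro sum_nonneg[of I "\<lambda>i. y i * (\<Sum>j\<in>I. b i j)"] mult_nonneg_nonneg) (auto simp: y_def)
  have 3: "0 \<le> (\<Sum>i\<in>I. \<Sum>j\<in>I. b i j)"
    by (rule sum_nonneg, rule Suc.prems(2)) auto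
  \<comment> \<open>Expansion of the form at \<open>x = y + m\<close>: the induction hypothesis
    bounds the first term, the row sums over \<open>I\<close> the other three.\<close>
  have "(\<Sum>i\<in>I. \<Sum>j\<in>I. b i j * (x i * x j)) =
     (\<Sum>i\<in>I. \<Sum>j\<in>I. b i j * (y i * y j)) + m * (\<Sum>i\<in>I. y i * (\<Sum>j\<in>I. b i j))
     + m * (\<Sum>i\<in>I. \<Sum>j\<in>I. y j * b i j) + m * m * (\<Sum>i\<in>I. \<Sum>j\<in>I. b i j)"
    by (simp add: y_def sum_distrib_left sum.distrib[symmetric] algebra_simps)
  also have "(\<Sum>i\<in>I. \<Sum>j\<in>I. y j * b i j) = (\<Sum>i\<in>I. y i * (\<Sum>j\<in>I. b i j))"
    by (subst sum.swap) (simp add: sum_distrib_left sym)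
  finally show ?case using 1 2 3 m0 by simp
qed

text \<open>If \<open>\<Sum> \<eta>\<^sup>2 = 1\<close>, two pairs with \<open>\<bar>\<eta>\<^sub>i - \<eta>\<^sub>j\<bar> > 1\<close> always meet and three never form a
  triangle, so all these pairs share a centre.\<close>
lemma far_pairs_star:
  fixes \<eta> :: "'i \<Rightarrow> real"
  assumes fin: "finite I" and norm1: "(\<Sum>i\<in>I. (\<eta> i)\<^sup>2) \<le> 1"
  shows "\<exists>c. \<forall>i\<in>I. \<forall>j\<in>I. (\<eta> i - \<eta> j)\<^sup>2 > 1 \<longrightarrow> i = c \<or> j = c"
proof -
  have sub: "(\<Sum>i\<in>S. (\<eta> i)\<^sup>2) \<le> 1" if "S \<subseteq> I" for S
    using sum_mono2[OF fin that, of "\<lambda>i. (\<eta> i)\<^sup>2"] norm1 by simp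
  have dbl: "(\<eta> i - \<eta> j)\<^sup>2 \<le> 2 * ((\<eta> i)\<^sup>2 + (\<eta> j)\<^sup>2)" for i j
    using zero_le_power2[of "\<eta> i + \<eta> j"] by (simp add: power2_eq_square algebra_simps)
  define far where "far i j \<longleftrightarrow> i \<in> I \<and> j \<in> I \<and> (\<eta> i - \<eta> j)\<^sup>2 > 1" for i j
  have farsym: "far i j \<Longrightarrow> far j i" for i j by (simp add: far_def power2_commute)
  have farne: "far i j \<Longrightarrow> i \<noteq> j" for i j by (auto simp: far_def)
  have meet: "i = k \<or> i = l \<or> j = k \<or> j = l" if "far i j" "far k l" for i j k l
  proof (rule ccontr)
    assume n: "\<not> ?thesis"
    have "(\<Sum>i\<in>{i,j,k,l}. (\<eta> i)\<^sup>2) \<le> 1" using that by (intro sub) (auto simp: far_def)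
    then have "(\<eta> i)\<^sup>2 + (\<eta> j)\<^sup>2 + (\<eta> k)\<^sup>2 + (\<eta> l)\<^sup>2 \<le> 1" using n farne[OF that(1)] farne[OF that(2)] by simp
    then show False using dbl[of i j] dbl[of k l] that by (simp add: far_def)
  qed
  \<comment> \<open>One of the three differences is, in absolute value, the sum of the other two and
    hence above 2, while the bound on the squares caps each at \<open>sqrt 2\<close>.\<close>
  have tri: False if f: "far i j" "far j k" "far i k" for i j k
  proof -
    have "(\<eta> p - \<eta> q)\<^sup>2 \<le> 2" if "far p q" for p q
      using sub[of "{p,q}"] dbl[of p q] that farne[OF that] by (simp add: far_def)
    then have "\<bar>\<eta> p - \<eta> q\<bar> \<le> sqrt 2" if "far p q" for p q
      using that real_le_rsqrt[of "\<bar>\<eta> p - \<eta> q\<bar>" 2] by simp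
    moreover have "sqrt 2 < (2::real)" using real_sqrt_less_iff[of 2 4] by simp
    moreover have "1 < \<bar>\<eta> p - \<eta> q\<bar>" if "far p q" for p q
      using that by (simp add: far_def abs_square_less_1[symmetric] not_less abs_square_le_1 flip: not_le)
    ultimately show False using f by (smt (verit))
  qed
  show ?thesis
  proof (cases "\<exists>i j. far i j")
    case False then show ?thesis by (auto simp: far_def)
  next
    case True
    then obtain i j where ij: "far i j" by blast
    \<comment> \<open>A far pair that avoids \<open>i\<close> contains \<open>j\<close>, and one
      that avoids \<open>j\<close> contains \<open>i\<close>. If both kinds existed, their other
      ends would coincide and close a triangle.\<close>
    have "(\<forall>k l. far k l \<longrightarrow> k = i \<or> l = i) \<or> (\<forall>k l. far k l \<longrightarrow> k = j \<or> l = j)"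
    proof (rule ccontr)
      assume "\<not> ?thesis"
      then obtain k l k' l' where f: "far k l" "k \<noteq> i" "l \<noteq> i" "far k' l'" "k' \<noteq> j" "l' \<noteq> j" by blast
      from f meet[OF ij f(1)] obtain p where p: "far j p" "p \<noteq> i" using farsym by metis
      from f meet[OF ij f(4)] obtain q where q: "far i q" "q \<noteq> j" using farsym by metis
      from meet[OF p(1) q(1)] have "p = q" using p q farne[OF ij] by auto
      then show False using tri[OF ij p(1)] q by simp
    qed
    then show ?thesis by (auto simp: far_def)
  qed
qed

text \<open>The squares add up to the Laplacian form of a star with \<open>card J\<close> edges,
  whose largest eigenvalue is \<open>card J + 1\<close>; subtracting 1 per edge leaves 1. The
  eigenvalue bound comes from the Cauchy-Schwarz inequality for \<open>s\<close>.\<close>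

lemma star_excess_le_1:
  fixes \<eta> :: "'i \<Rightarrow> real"
  assumes fin: "finite I" and norm1: "(\<Sum>i\<in>I. (\<eta> i)\<^sup>2) \<le> 1" and c: "c \<in> I" and J: "J \<subseteq> I - {c}"
  shows "(\<Sum>j\<in>J. (\<eta> c - \<eta> j)\<^sup>2 - 1) \<le> 1"
proof -
  have finJ: "finite J" using fin J finite_subset by blast
  define k q s where "k = real (card J)" and "q = (\<Sum>j\<in>J. (\<eta> j)\<^sup>2)" and "s = (\<Sum>j\<in>J. \<eta> j)"
  have cs: "s\<^sup>2 \<le> k * q"
    using Cauchy_Schwarz_ineq_sum[of "\<lambda>_. 1" \<eta> J] by (simp add: s_def k_def q_def)
  have "(\<Sum>i\<in>insert c J. (\<eta> i)\<^sup>2) \<le> 1"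
    using sum_mono2[of I "insert c J" "\<lambda>i. (\<eta> i)\<^sup>2"] fin c J norm1 by fastforce
  then have nq: "(\<eta> c)\<^sup>2 + q \<le> 1" using finJ J by (subst (asm) sum.insert) (auto simp: q_def)
  have eq: "(\<Sum>j\<in>J. (\<eta> c - \<eta> j)\<^sup>2 - 1) = k * (\<eta> c)\<^sup>2 - 2 * \<eta> c * s + q - k"
    by (simp add: power2_diff sum.distrib sum_subtractf k_def q_def s_def sum_distrib_left)
  have "k * (\<eta> c)\<^sup>2 - 2 * \<eta> c * s + q \<le> (k + 1) * ((\<eta> c)\<^sup>2 + q)"
    \<comment> \<open>\<open>0 \<le> (\<eta>\<^sub>c + s)\<^sup>2 \<le> \<eta>\<^sub>c\<^sup>2 + 2 \<eta>\<^sub>c s + k q\<close>\<close>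
    using cs zero_le_power2[of "\<eta> c + s"] by (simp add: power2_sum algebra_simps)
  moreover have "(k + 1) * ((\<eta> c)\<^sup>2 + q) \<le> (k + 1) * 1"
    using nq by (intro mult_left_mono) (auto simp: k_def)
  ultimately have "k * (\<eta> c)\<^sup>2 - 2 * \<eta> c * s + q \<le> k + 1" by simp
  then show ?thesis unfolding eq by simp
qed

section \<open>Commutators of symmetric matrices\<close>

lemma inner_matrix_eq_sum_rows: "(X::real^'n^'m) \<bullet> Y = (\<Sum>i\<in>UNIV. X $ i \<bullet> Y $ i)"
  by (simp add: inner_vec_def)

text \<open>The norm of the type \<open>real^'n^'m\<close> is the Frobenius norm, so each row can be
  expanded by Parseval in any orthonormal basis.\<close>

lemma norm_matrix_onb:
  fixes X :: "real^'n^'m" and B :: "(real^'n) set"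
  assumes "finite B" "pairwise orthogonal B" "\<And>b. b \<in> B \<Longrightarrow> norm b = 1" "span B = UNIV"
  shows "(norm X)\<^sup>2 = (\<Sum>c\<in>B. (norm (X *v c))\<^sup>2)"
proof -
  have "(norm X)\<^sup>2 = (\<Sum>i\<in>UNIV. X $ i \<bullet> X $ i)"
    by (simp add: power2_norm_eq_inner inner_matrix_eq_sum_rows)
  also have "\<dots> = (\<Sum>i\<in>UNIV. \<Sum>c\<in>B. (X $ i \<bullet> c)\<^sup>2)"
    by (intro sum.cong refl, subst onb_parseval[of B])
       (use assms in \<open>auto simp: power2_eq_square inner_commute\<close>)
  also have "\<dots> = (\<Sum>c\<in>B. \<Sum>i\<in>UNIV. (X $ i \<bullet> c)\<^sup>2)" by (rule sum.swap)
  also have "\<dots> = (\<Sum>c\<in>B. (norm (X *v c))\<^sup>2)"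
    unfolding power2_norm_eq_inner inner_vec_def by (simp add: matrix_vector_mul_component inner_vec_def power2_eq_square)
  finally show ?thesis .
qed

definition commutator :: "real^'n^'n \<Rightarrow> real^'n^'n \<Rightarrow> real^'n^'n" where
  "commutator X Y = X ** Y - Y ** X"

lemma linear_commutator: "linear (commutator X)"
  by (rule linearI)
     (simp_all add: vec_eq_iff commutator_def matrix_matrix_mult_def sum.distrib sum_distrib_left
       scaleR_diff_right algebra_simps)

lemma commutator_swap: "commutator X Y = - commutator Y X"
  by (simp add: commutator_def)

lemma symmetric_matrix_inner:
  fixes X :: "real^'n^'n"
  assumes "transpose X = X"
  shows "(X *v u) \<bullet> v = u \<bullet> (X *v v)"
  using dot_lmul_matrix[of u X v] transpose_matrix_vector[of X u] assms by simp

lemma subspace_symmetric: "subspace {X :: real^'n^'n. transpose X = X}"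
  by (auto simp: subspace_def transpose_def vec_eq_iff)

text \<open>In an eigenbasis of \<open>A\<close> the entries of the commutator with \<open>E\<close>
  are those of \<open>E\<close> times eigenvalue gaps. Hence the excess over
  \<open>real (card (S - {A}))\<close> is a sum of squared entries of the \<open>E\<close> with
  weights \<open>p b c\<close>, positive only for pairs that contain one fixed \<open>z\<close>.
  Bessel's inequality caps the total squared entry at such a pair by 1/2, and each pair occurs in
  both orders, so \<open>star_excess_le_1\<close> bounds the excess by 1. The matrix
  \<open>A\<close> pays for this 1: it counts in \<open>card S\<close> and commutes with
  itself.\<close>

lemma sum_commutators_orthonormal_le:
  fixes A :: "real^'n^'n"
  assumes S: "finite S" "pairwise orthogonal S" "\<And>E. E \<in> S \<Longrightarrow> norm E = 1"
    and sym: "\<And>E. E \<in> S \<Longrightarrow> transpose E = E" and A: "A \<in> S"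
  shows "(\<Sum>E\<in>S. (norm (commutator A E))\<^sup>2) \<le> real (card S)"
proof -
  obtain B \<eta> where B: "finite B" "pairwise orthogonal B" "\<And>b. b \<in> B \<Longrightarrow> norm b = 1" "span B = UNIV"
    and eig: "\<And>b. b \<in> B \<Longrightarrow> A *v b = \<eta> b *\<^sub>R b"
    using spectral_basis[of "(*v) A" UNIV] symmetric_matrix_inner[OF sym[OF A]]
    by (metis subspace_UNIV subset_UNIV matrix_vector_mul_linear)
  have \<eta>1: "(\<Sum>b\<in>B. (\<eta> b)\<^sup>2) = 1"
    using norm_matrix_onb[OF B, of A] S(3)[OF A] eig B(3) by simp
  have expand: "(norm v)\<^sup>2 = (\<Sum>b\<in>B. (b \<bullet> v)\<^sup>2)" for v
    unfolding power2_norm_eq_inner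
    using onb_parseval[OF B(1-3), of v v] B(4) by (simp add: power2_eq_square inner_commute)
  have entry: "b \<bullet> (commutator A E *v c) = (\<eta> b - \<eta> c) * (b \<bullet> (E *v c))" if "b \<in> B" "c \<in> B" for b c E
  proof -
    have "b \<bullet> (commutator A E *v c) = b \<bullet> (A *v (E *v c)) - b \<bullet> (E *v (A *v c))"
      by (simp add: commutator_def matrix_vector_mult_diff_rdistrib matrix_vector_mul_assoc inner_diff_right)
    also have "b \<bullet> (A *v (E *v c)) = \<eta> b * (b \<bullet> (E *v c))"
      using symmetric_matrix_inner[OF sym[OF A], of b "E *v c"] eig[OF that(1)] by simp
    finally show ?thesis using eig[OF that(2)] by (simp add: matrix_vector_mult_scaleR algebra_simps)
  qed
  define r where "r b c = (\<Sum>E\<in>S - {A}. (b \<bullet> (E *v c))\<^sup>2)" for b c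
  have r0: "0 \<le> r b c" for b c by (simp add: r_def sum_nonneg)
  have rsym: "r b c = r c b" for b c
    unfolding r_def using symmetric_matrix_inner[OF sym] by (intro sum.cong refl) (simp add: inner_commute)
  have r_half: "r b c \<le> 1 / 2" if "b \<in> B" "c \<in> B" "b \<noteq> c" for b c
  proof -
    \<comment> \<open>For symmetric \<open>E\<close> the entry at an off-diagonal pair is half the
      inner product with this matrix, whose squared norm is 2. This improves the bound 1, valid for
      arbitrary orthonormal matrices, to 1/2.\<close>
    define F :: "real^'n^'n" where "F = (\<chi> i j. b $ i * c $ j + c $ i * b $ j)"
    have EF: "E \<bullet> F = 2 * (b \<bullet> (E *v c))" if "E \<in> S" for E
    proof -
      have "E \<bullet> F = b \<bullet> (E *v c) + c \<bullet> (E *v b)"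
        by (simp add: F_def inner_vec_def matrix_vector_mult_def sum_distrib_left sum.distrib algebra_simps)
      then show ?thesis using symmetric_matrix_inner[OF sym[OF that], of c b] by (simp add: inner_commute)
    qed
    have Fv: "F *v v = (c \<bullet> v) *\<^sub>R b + (b \<bullet> v) *\<^sub>R c" for v
      by (simp add: vec_eq_iff F_def matrix_vector_mult_def inner_vec_def sum_distrib_left sum.distrib algebra_simps)
    have "(norm (F *v a))\<^sup>2 = (if a = b then 1 else 0) + (if a = c then 1 else 0)" if "a \<in> B" for a
      using onb_inner[OF B(2,3)] \<open>b \<in> B\<close> \<open>c \<in> B\<close> that \<open>b \<noteq> c\<close> B(3) by (auto simp: Fv)
    then have F2: "(norm F)\<^sup>2 = 2"
      using norm_matrix_onb[OF B, of F] B(1) that by (simp add: sum.distrib)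
    have "4 * r b c = (\<Sum>E\<in>S - {A}. (E \<bullet> F)\<^sup>2)"
      unfolding r_def sum_distrib_left by (intro sum.cong refl) (simp add: EF power_mult_distrib)
    also have "\<dots> \<le> (\<Sum>E\<in>S. (E \<bullet> F)\<^sup>2)" using S(1) by (intro sum_mono2) auto
    also have "\<dots> \<le> (norm F)\<^sup>2" by (rule bessel_inequality[OF S])
    finally show ?thesis using F2 by simp
  qed
  have nE: "(norm X)\<^sup>2 = (\<Sum>b\<in>B. \<Sum>c\<in>B. (b \<bullet> (X *v c))\<^sup>2)" for X :: "real^'n^'n"
    using norm_matrix_onb[OF B, of X] unfolding expand by (subst sum.swap) simp
  define p where "p b c = (\<eta> b - \<eta> c)\<^sup>2 - 1" for b c
  have psym: "p b c = p c b" for b c by (simp add: p_def power2_commute)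
  have excess: "(\<Sum>E\<in>S-{A}. (norm (commutator A E))\<^sup>2 - (norm E)\<^sup>2) = (\<Sum>b\<in>B. \<Sum>c\<in>B. p b c * r b c)"
  proof -
    have term_eq: "(b \<bullet> (commutator A E *v c))\<^sup>2 - (b \<bullet> (E *v c))\<^sup>2 = p b c * (b \<bullet> (E *v c))\<^sup>2"
      if "b \<in> B" "c \<in> B" for b c E
      unfolding entry[OF that] p_def power_mult_distrib by (simp add: left_diff_distrib)
    have "(\<Sum>E\<in>S-{A}. (norm (commutator A E))\<^sup>2 - (norm E)\<^sup>2) =
          (\<Sum>E\<in>S-{A}. \<Sum>b\<in>B. \<Sum>c\<in>B. p b c * (b \<bullet> (E *v c))\<^sup>2)"
      unfolding nE sum_subtractf[symmetric]
      by (intro sum.cong refl) (simp add: term_eq)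
    also have "\<dots> = (\<Sum>b\<in>B. \<Sum>c\<in>B. p b c * r b c)"
      by (simp add: r_def sum_distrib_left sum.swap[of _ "S - {A}"])
    finally show ?thesis .
  qed
  obtain z where z: "\<And>i j. i \<in> B \<Longrightarrow> j \<in> B \<Longrightarrow> (\<eta> i - \<eta> j)\<^sup>2 > 1 \<Longrightarrow> i = z \<or> j = z"
    using far_pairs_star[OF B(1), of \<eta>] \<eta>1 by auto
  have bound: "(\<Sum>b\<in>B. \<Sum>c\<in>B. p b c * r b c) \<le> 1"
  proof (cases "z \<in> B")
    \<comment> \<open>Then no pair in \<open>B\<close> has a gap above 1, since it would contain
      \<open>z\<close>.\<close>
    case False
    have "(\<Sum>b\<in>B. \<Sum>c\<in>B. p b c * r b c) \<le> (\<Sum>b\<in>B. \<Sum>c\<in>B. 0)"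
    proof (intro sum_mono)
      fix b c assume bc: "b \<in> B" "c \<in> B"
      then have "p b c \<le> 0" using z[OF bc] False by (force simp: p_def)
      then show "p b c * r b c \<le> 0" using r0 by (simp add: mult_nonpos_nonneg)
    qed
    then show ?thesis by simp
  next
    case True
    define J where "J = {j \<in> B. p z j > 0}"
    have zJ: "z \<notin> J" by (simp add: J_def p_def)
    have finJ: "finite J" "J \<subseteq> B" using B(1) by (auto simp: J_def)
    \<comment> \<open>Only positive weights are kept: they sit in row \<open>z\<close> and in column
      \<open>z\<close>, and each carries at most half of its \<open>p z c\<close>.\<close>
    have "p b c * r b c \<le> (if b = z \<and> c \<in> J then p z c / 2 else 0) + (if c = z \<and> b \<in> J then p z b / 2 else 0)"
      if bc: "b \<in> B" "c \<in> B" for b c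
    proof (cases "p b c > 0")
      case False
      then have "p b c * r b c \<le> 0" using r0 by (simp add: mult_nonpos_nonneg)
      then show ?thesis by (rule order_trans, intro add_nonneg_nonneg) (auto simp: J_def)
    next
      case pos: True
      then have "b \<noteq> c" by (auto simp: p_def)
      then have "p b c * r b c \<le> p b c * (1/2)" using pos r_half[OF bc] by (intro mult_left_mono) auto
      moreover have "b = z \<or> c = z" using z[OF bc] pos by (simp add: p_def)
      ultimately show ?thesis using pos \<open>b \<noteq> c\<close> bc psym[of b c] by (auto simp: J_def)
    qed
    then have "(\<Sum>b\<in>B. \<Sum>c\<in>B. p b c * r b c) \<le> (\<Sum>b\<in>B. \<Sum>c\<in>B. (if b = z \<and> c \<in> J then p z c / 2 else 0) + (if c = z \<and> b \<in> J then p z b / 2 else 0))"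
      by (intro sum_mono) blast
    also have "\<dots> = (\<Sum>c\<in>B. if c \<in> J then p z c / 2 else 0) + (\<Sum>b\<in>B. if b \<in> J then p z b / 2 else 0)"
    proof -
      have "(\<Sum>b\<in>B. \<Sum>c\<in>B. if b = z \<and> c \<in> J then p z c / 2 else 0) = (\<Sum>b\<in>B. if b = z then (\<Sum>c\<in>B. if c \<in> J then p z c / 2 else 0) else 0)"
        by (intro sum.cong refl) auto
      moreover have "(\<Sum>b\<in>B. \<Sum>c\<in>B. if c = z \<and> b \<in> J then p z b / 2 else 0) = (\<Sum>b\<in>B. \<Sum>c\<in>B. if c = z then (if b \<in> J then p z b / 2 else 0) else 0)"
        by (intro sum.cong refl) auto
      ultimately show ?thesis using True B(1) by (simp add: sum.distrib)
    qed
    also have "(\<Sum>c\<in>B. if c \<in> J then p z c / 2 else 0) = (\<Sum>c\<in>J. p z c / 2)"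
      using finJ B(1) by (simp add: sum.If_cases Int_absorb1)
    also have "(\<Sum>c\<in>J. p z c / 2) + (\<Sum>c\<in>J. p z c / 2) = (\<Sum>c\<in>J. p z c)"
      by (simp add: sum_divide_distrib[symmetric])
    also have "\<dots> \<le> 1" unfolding p_def
      using star_excess_le_1[OF B(1) _ True, of \<eta> J] \<eta>1 zJ finJ by auto
    finally show ?thesis .
  qed
  have "(\<Sum>E\<in>S-{A}. (norm (commutator A E))\<^sup>2) - real (card (S - {A})) \<le> 1"
    using excess bound S by (simp add: sum_subtractf)
  moreover have "(\<Sum>E\<in>S. (norm (commutator A E))\<^sup>2) = (\<Sum>E\<in>S-{A}. (norm (commutator A E))\<^sup>2)"
    using S(1) A by (simp add: sum.remove commutator_def)
  moreover have "real (card S) = real (card (S - {A})) + 1"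
    using S(1) A by (metis card.remove Suc_eq_plus1 of_nat_Suc add.commute)
  ultimately show ?thesis by linarith
qed

text \<open>After diagonalisation both sides are quadratic forms in the eigenvalues
  \<open>l\<close>, with coefficients \<open>k b a\<close> and 1. Their difference has nonnegative
  row sums over every subset by \<open>sum_commutators_orthonormal_le\<close>.\<close>

theorem ddvv_inequality:
  fixes A :: "'r \<Rightarrow> real^'n^'n"
  assumes I: "finite I" and sym: "\<And>r. r \<in> I \<Longrightarrow> transpose (A r) = A r"
  shows "(\<Sum>r\<in>I. \<Sum>s\<in>I. (norm (commutator (A r) (A s)))\<^sup>2) \<le> (\<Sum>r\<in>I. (norm (A r))\<^sup>2)\<^sup>2"
proof -
  obtain B l where B: "finite B" "B \<subseteq> {X :: real^'n^'n. transpose X = X}" "pairwise orthogonal B"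
      "\<And>b. b \<in> B \<Longrightarrow> norm b = 1" "\<And>b. b \<in> B \<Longrightarrow> 0 \<le> l b"
    and T: "\<And>T :: real^'n^'n \<Rightarrow> real^'n^'n. linear T \<Longrightarrow> (\<Sum>r\<in>I. (norm (T (A r)))\<^sup>2) = (\<Sum>b\<in>B. l b * (norm (T b))\<^sup>2)"
    and tr: "(\<Sum>r\<in>I. (norm (A r))\<^sup>2) = (\<Sum>b\<in>B. l b)"
    using gram_diagonalization[OF I subspace_symmetric, of A] sym by auto
  define k where "k a b = (norm (commutator a b))\<^sup>2" for a b :: "real^'n^'n"
  have ksym: "k a b = k b a" for a b unfolding k_def by (subst commutator_swap) simp
  \<comment> \<open>The diagonalisation is used twice: with the linear map
    \<open>commutator (A r)\<close> for the sum over \<open>s\<close>, then with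
    \<open>commutator b\<close> for the sum over \<open>r\<close>.\<close>
  have "(\<Sum>r\<in>I. \<Sum>s\<in>I. k (A r) (A s)) = (\<Sum>r\<in>I. \<Sum>b\<in>B. l b * k (A r) b)"
    unfolding k_def by (intro sum.cong refl T linear_commutator)
  also have "\<dots> = (\<Sum>b\<in>B. l b * (\<Sum>r\<in>I. k b (A r)))"
    by (subst sum.swap) (simp add: sum_distrib_left ksym)
  also have "\<dots> = (\<Sum>b\<in>B. \<Sum>a\<in>B. k b a * (l b * l a))"
    unfolding k_def T[OF linear_commutator] by (simp add: sum_distrib_left mult_ac)
  finally have 1: "(\<Sum>r\<in>I. \<Sum>s\<in>I. k (A r) (A s)) = (\<Sum>b\<in>B. \<Sum>a\<in>B. k b a * (l b * l a))" .
  have "0 \<le> (\<Sum>b\<in>B. \<Sum>a\<in>B. (1 - k b a) * (l b * l a))"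
  proof (rule nonneg_form_if_row_sums_nonneg[OF B(1)])
    show "0 \<le> (\<Sum>a\<in>S. 1 - k b a)" if "S \<subseteq> B" "b \<in> S" for S b
      using sum_commutators_orthonormal_le[of S b] that B finite_subset[OF that(1) B(1)]
        pairwise_subset[OF B(3) that(1)] by (auto simp: sum_subtractf k_def)
  qed (use B(5) ksym in auto)
  also have "\<dots> = (\<Sum>b\<in>B. l b)\<^sup>2 - (\<Sum>b\<in>B. \<Sum>a\<in>B. k b a * (l b * l a))"
    by (simp add: algebra_simps sum_subtractf sum_product power2_eq_square)
  finally show ?thesis using 1 tr by (simp add: k_def)
qed

section \<open>Calculus\<close>

abbreviation (input) dd :: "('a::real_normed_vector \<Rightarrow> 'b::real_normed_vector) \<Rightarrow> 'a \<Rightarrow> 'a \<Rightarrow> 'b" where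
  "dd f y \<equiv> frechet_derivative f (at y)"

lemma dd_eqI: "(f has_derivative f') (at y) \<Longrightarrow> dd f y = f'"
  using frechet_derivative_at by metis

lemma dd_works: "f differentiable (at y) \<Longrightarrow> (f has_derivative dd f y) (at y)"
  by (simp add: frechet_derivative_works)

lemma has_derivative_differentiable: "(f has_derivative f') (at y) \<Longrightarrow> f differentiable (at y)"
  by (auto simp: differentiable_def)

lemma dd_bounded_linear:
  assumes "bounded_linear L" "f differentiable (at y)"
  shows "dd (\<lambda>z. L (f z)) y v = L (dd f y v)"
  using dd_eqI[OF bounded_linear.has_derivative[OF assms(1) dd_works[OF assms(2)]]] by simp

lemma differentiable_bounded_linear:
  assumes "bounded_linear L" "f differentiable (at y)"
  shows "(\<lambda>z. L (f z)) differentiable (at y)"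
  using has_derivative_differentiable[OF bounded_linear.has_derivative[OF assms(1) dd_works[OF assms(2)]]] .

lemma dd_compose:
  assumes "f differentiable (at y)" "g differentiable (at (f y))"
  shows "dd (\<lambda>z. g (f z)) y v = dd g (f y) (dd f y v)"
  using frechet_derivative_compose[OF assms] by (simp add: o_def)

lemma dd_cong_open:
  assumes "open X" "y \<in> X" "\<And>z. z \<in> X \<Longrightarrow> f z = g z" "g differentiable (at y)"
  shows "dd f y = dd g y"
  using frechet_derivative_transform_within_open[of g y X f] assms by simp

lemma differentiable_cong_open:
  assumes "open X" "y \<in> X" "\<And>z. z \<in> X \<Longrightarrow> f z = g z" "g differentiable (at y)"
  shows "f differentiable (at y)"
  using has_derivative_transform_within_open[OF dd_works[OF assms(4)] assms(1,2), of f] assms(3)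
  by (auto simp: differentiable_def)

text \<open>Product rule for linear maps whose dependence on \<open>z\<close> is known only for each
  fixed argument. Expanding \<open>a z\<close> in \<open>Basis\<close> reduces it to finitely many
  scalar multiples; linearity throughout \<open>S\<close> justifies the expansion before
  differentiating.\<close>

lemma has_derivative_linear_apply:
  fixes L :: "'a::euclidean_space \<Rightarrow> 'b::euclidean_space \<Rightarrow> 'c::real_normed_vector"
  assumes S: "open S" "y \<in> S" and lin: "\<And>z. z \<in> S \<Longrightarrow> linear (L z)"
    and L: "\<And>w. (\<lambda>z. L z w) differentiable (at y)" and a: "a differentiable (at y)"
  shows "((\<lambda>z. L z (a z)) has_derivative (\<lambda>h. dd (\<lambda>z. L z (a y)) y h + L y (dd a y h))) (at y)"
proof -
  have ex: "L z w = (\<Sum>b\<in>Basis. (w \<bullet> b) *\<^sub>R L z b)" if "z \<in> S" for z w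
    by (subst euclidean_representation[of w, symmetric])
       (simp only: linear_sum[OF lin[OF that]] linear_scale[OF lin[OF that]])
  have "((\<lambda>z. \<Sum>b\<in>Basis. (a z \<bullet> b) *\<^sub>R L z b) has_derivative
      (\<lambda>h. \<Sum>b\<in>Basis. (a y \<bullet> b) *\<^sub>R dd (\<lambda>z. L z b) y h + (dd a y h \<bullet> b) *\<^sub>R L y b)) (at y)"
    by (intro has_derivative_sum has_derivative_scaleR has_derivative_inner_left dd_works L a)
  then have 1: "((\<lambda>z. L z (a z)) has_derivative
      (\<lambda>h. \<Sum>b\<in>Basis. (a y \<bullet> b) *\<^sub>R dd (\<lambda>z. L z b) y h + (dd a y h \<bullet> b) *\<^sub>R L y b)) (at y)"
    by (rule has_derivative_transform_within_open[OF _ S]) (rule ex[symmetric])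
  have "((\<lambda>z. \<Sum>b\<in>Basis. (a y \<bullet> b) *\<^sub>R L z b) has_derivative
      (\<lambda>h. \<Sum>b\<in>Basis. (a y \<bullet> b) *\<^sub>R dd (\<lambda>z. L z b) y h)) (at y)"
    by (intro has_derivative_sum has_derivative_scaleR_right dd_works L)
  then have "((\<lambda>z. L z (a y)) has_derivative
      (\<lambda>h. \<Sum>b\<in>Basis. (a y \<bullet> b) *\<^sub>R dd (\<lambda>z. L z b) y h)) (at y)"
    by (rule has_derivative_transform_within_open[OF _ S]) (rule ex[symmetric])
  from dd_eqI[OF this] show ?thesis using 1 by (simp add: sum.distrib ex[OF S(2), of "dd a y _"])
qed

lemma has_derivative_bilinear_apply:
  fixes B :: "'a::euclidean_space \<Rightarrow> 'b::euclidean_space \<Rightarrow> 'c::euclidean_space \<Rightarrow> 'd::real_normed_vector"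
  assumes S: "open S" "y \<in> S" and bil: "\<And>z. z \<in> S \<Longrightarrow> bilinear (B z)"
    and B: "\<And>v w. (\<lambda>z. B z v w) differentiable (at y)"
    and a: "a differentiable (at y)" and b: "b differentiable (at y)"
  shows "((\<lambda>z. B z (a z) (b z)) has_derivative
     (\<lambda>h. dd (\<lambda>z. B z (a y) (b y)) y h + B y (dd a y h) (b y) + B y (a y) (dd b y h))) (at y)"
proof -
  have 1: "((\<lambda>z. B z (a z) w) has_derivative (\<lambda>h. dd (\<lambda>z. B z (a y) w) y h + B y (dd a y h) w)) (at y)" for w
    by (rule has_derivative_linear_apply[where L = "\<lambda>z v. B z v w", OF S _ B a])
       (use bil in \<open>auto simp: bilinear_def\<close>)
  have "((\<lambda>z. B z (a z) (b z)) has_derivative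
      (\<lambda>h. dd (\<lambda>z. B z (a z) (b y)) y h + B y (a y) (dd b y h))) (at y)"
    by (rule has_derivative_linear_apply[where L = "\<lambda>z. B z (a z)", OF S _ has_derivative_differentiable[OF 1] b])
       (use bil in \<open>auto simp: bilinear_def\<close>)
  then show ?thesis by (simp add: dd_eqI[OF 1])
qed

lemma smooth_on_differentiable: "smooth_on S f \<Longrightarrow> y \<in> S \<Longrightarrow> f differentiable (at y)"
  unfolding smooth_on_def using Ck_on.simps(2)[of 0 f S] by blast

lemma smooth_on_dd: "smooth_on S f \<Longrightarrow> smooth_on S (\<lambda>z. dd f z v)"
  unfolding smooth_on_def using Ck_on.simps(2) by blast

lemma smooth_on_continuous: "smooth_on S f \<Longrightarrow> continuous_on S f"
  unfolding smooth_on_def using Ck_on.simps(1) by blast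

lemma Ck_on_subset: "Ck_on k f S \<Longrightarrow> T \<subseteq> S \<Longrightarrow> Ck_on k f T"
  by (induction k arbitrary: f) (auto intro: continuous_on_subset)

lemma smooth_on_subset: "smooth_on S f \<Longrightarrow> T \<subseteq> S \<Longrightarrow> smooth_on T f"
  unfolding smooth_on_def using Ck_on_subset by blast

section \<open>Symmetry of second derivatives\<close>

lemma DERIV_along_line:
  assumes "h differentiable (at (x + r *\<^sub>R v))"
  shows "((\<lambda>r. h (x + r *\<^sub>R v)) has_real_derivative dd h (x + r *\<^sub>R v) v) (at r)"
proof -
  have 1: "((\<lambda>r. x + r *\<^sub>R v) has_derivative (\<lambda>t. t *\<^sub>R v)) (at r)"
    by (auto intro!: derivative_eq_intros)
  have "((\<lambda>r. h (x + r *\<^sub>R v)) has_derivative (\<lambda>t. dd h (x + r *\<^sub>R v) (t *\<^sub>R v))) (at r)"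
    by (rule has_derivative_compose[OF 1 dd_works[OF assms]])
  moreover have "dd h (x + r *\<^sub>R v) (t *\<^sub>R v) = dd h (x + r *\<^sub>R v) v * t" for t
    using linear_scale[OF linear_frechet_derivative[OF assms], of t v] by simp
  ultimately show ?thesis by (simp add: has_field_derivative_def)
qed

text \<open>The second difference is symmetric in \<open>u\<close> and \<open>v\<close>, while the
  right-hand side is a mixed derivative in a chosen order. One mean value theorem along
  \<open>u\<close> and another along \<open>v\<close> produce it.\<close>

lemma second_difference_mvt:
  fixes f :: "'a::euclidean_space \<Rightarrow> real"
  assumes t: "t > 0" "t * (norm u + norm v) < \<delta>" and sub: "ball y \<delta> \<subseteq> S"
    and f: "\<And>z. z \<in> S \<Longrightarrow> f differentiable (at z)" and fu: "\<And>z. z \<in> S \<Longrightarrow> (\<lambda>z. dd f z u) differentiable (at z)"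
  shows "\<exists>p \<in> ball y \<delta>. f (y + t *\<^sub>R u + t *\<^sub>R v) - f (y + t *\<^sub>R u) - f (y + t *\<^sub>R v) + f y = t\<^sup>2 * dd (\<lambda>z. dd f z u) p v"
proof -
  have mem: "y + s *\<^sub>R u + r *\<^sub>R v \<in> ball y \<delta>" if "0 \<le> s" "s \<le> t" "0 \<le> r" "r \<le> t" for s r
  proof -
    have "norm (s *\<^sub>R u + r *\<^sub>R v) \<le> s * norm u + r * norm v" using that by (metis norm_triangle_le norm_scaleR abs_of_nonneg order_refl add_mono)
    also have "\<dots> \<le> t * norm u + t * norm v" using that by (intro add_mono mult_right_mono) auto
    also have "\<dots> < \<delta>" using t by (simp add: algebra_simps)
    finally have "norm (s *\<^sub>R u + r *\<^sub>R v) < \<delta>" .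
    then have "dist (y + (s *\<^sub>R u + r *\<^sub>R v)) y < \<delta>" by (simp only: dist_norm add_diff_cancel_left')
    then show ?thesis by (simp add: dist_commute add.assoc)
  qed
  have mem': "y + s *\<^sub>R u \<in> ball y \<delta>" if "0 \<le> s" "s \<le> t" for s using mem[OF that, of 0] t by simp
  have "\<exists>s. 0 < s \<and> s < t \<and> (f (y + t *\<^sub>R v + t *\<^sub>R u) - f (y + t *\<^sub>R u)) - (f (y + t *\<^sub>R v + 0 *\<^sub>R u) - f (y + 0 *\<^sub>R u))
      = (t - 0) * (dd f (y + t *\<^sub>R v + s *\<^sub>R u) u - dd f (y + s *\<^sub>R u) u)"
  proof (rule MVT2[OF t(1)])
    fix s assume s: "0 \<le> s" "s \<le> t"
    have "y + t *\<^sub>R v + s *\<^sub>R u \<in> S" using mem[OF s, of t] t sub by (auto simp: ac_simps)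
    moreover have "y + s *\<^sub>R u \<in> S" using mem'[OF s] sub by auto
    ultimately show "((\<lambda>s. f (y + t *\<^sub>R v + s *\<^sub>R u) - f (y + s *\<^sub>R u)) has_real_derivative
        dd f (y + t *\<^sub>R v + s *\<^sub>R u) u - dd f (y + s *\<^sub>R u) u) (at s)"
      by (intro DERIV_diff DERIV_along_line f)
  qed
  then obtain s where s: "0 < s" "s < t" and eq1:
    "f (y + t *\<^sub>R u + t *\<^sub>R v) - f (y + t *\<^sub>R u) - f (y + t *\<^sub>R v) + f y = t * (dd f (y + s *\<^sub>R u + t *\<^sub>R v) u - dd f (y + s *\<^sub>R u) u)"
    by (auto simp: ac_simps)
  have "\<exists>r. 0 < r \<and> r < t \<and> dd f (y + s *\<^sub>R u + t *\<^sub>R v) u - dd f (y + s *\<^sub>R u + 0 *\<^sub>R v) u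
      = (t - 0) * dd (\<lambda>z. dd f z u) (y + s *\<^sub>R u + r *\<^sub>R v) v"
  proof (rule MVT2[OF t(1)])
    fix r assume r: "0 \<le> r" "r \<le> t"
    have "y + s *\<^sub>R u + r *\<^sub>R v \<in> S" using mem[of s r] s r sub by auto
    then show "((\<lambda>r. dd f (y + s *\<^sub>R u + r *\<^sub>R v) u) has_real_derivative
        dd (\<lambda>z. dd f z u) (y + s *\<^sub>R u + r *\<^sub>R v) v) (at r)"
      by (intro DERIV_along_line[where h = "\<lambda>z. dd f z u"] fu)
  qed
  then obtain r where r: "0 < r" "r < t" and eq2: "dd f (y + s *\<^sub>R u + t *\<^sub>R v) u - dd f (y + s *\<^sub>R u) u
      = t * dd (\<lambda>z. dd f z u) (y + s *\<^sub>R u + r *\<^sub>R v) v"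
    by auto
  show ?thesis
    using mem[of s r] s r eq1 eq2 by (intro bexI[of _ "y + s *\<^sub>R u + r *\<^sub>R v"]) (auto simp: power2_eq_square)
qed

text \<open>Both orders of the mixed derivative, at suitable points near \<open>y\<close>, equal the
  same second difference divided by \<open>t\<^sup>2\<close>, and continuity carries this to
  \<open>y\<close>. With \<open>e\<close> half of the supposed gap, errors below \<open>e\<close> on
  both sides cannot bridge it.\<close>

lemma second_derivative_symmetric_real:
  fixes f :: "'a::euclidean_space \<Rightarrow> real"
  assumes S: "open S" "y \<in> S" and f: "smooth_on S f"
  shows "dd (\<lambda>z. dd f z u) y v = dd (\<lambda>z. dd f z v) y u"
proof (rule ccontr)
  assume ne: "\<not> ?thesis"
  define e where "e = \<bar>dd (\<lambda>z. dd f z u) y v - dd (\<lambda>z. dd f z v) y u\<bar> / 2"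
  have e: "e > 0" using ne by (simp add: e_def)
  have cont: "isCont (\<lambda>z. dd (\<lambda>z. dd f z u) z v) y" for u v
    using smooth_on_continuous[OF smooth_on_dd[OF smooth_on_dd[OF f]]] S
    by (simp add: continuous_on_eq_continuous_at)
  obtain d1 where d1: "d1 > 0" "\<And>z. dist z y < d1 \<Longrightarrow> \<bar>dd (\<lambda>z. dd f z u) z v - dd (\<lambda>z. dd f z u) y v\<bar> < e"
    using cont[of u v] e unfolding continuous_at_eps_delta dist_real_def by blast
  obtain d2 where d2: "d2 > 0" "\<And>z. dist z y < d2 \<Longrightarrow> \<bar>dd (\<lambda>z. dd f z v) z u - dd (\<lambda>z. dd f z v) y u\<bar> < e"
    using cont[of v u] e unfolding continuous_at_eps_delta dist_real_def by blast
  obtain d3 where d3: "d3 > 0" "ball y d3 \<subseteq> S" using S open_contains_ball by blast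
  define \<delta> where "\<delta> = min d1 (min d2 d3)"
  have \<delta>: "\<delta> > 0" "ball y \<delta> \<subseteq> S" using d1 d2 d3 by (auto simp: \<delta>_def)
  \<comment> \<open>The \<open>+ 1\<close> makes the denominator positive and
    \<open>t * (norm u + norm v)\<close> strictly smaller than \<open>\<delta>\<close>.\<close>
  define t where "t = \<delta> / (norm u + norm v + 1)"
  have pos: "norm u + norm v + 1 > 0" by (simp add: add_nonneg_pos)
  have t: "t > 0" using \<delta> pos by (simp add: t_def)
  have "t * (norm u + norm v + 1) = \<delta>" using pos by (simp add: t_def)
  then have t': "t * (norm u + norm v) < \<delta>" "t * (norm v + norm u) < \<delta>" using t by (simp_all add: algebra_simps)
  note df = smooth_on_differentiable[OF f] smooth_on_differentiable[OF smooth_on_dd[OF f]]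
  obtain p where p: "p \<in> ball y \<delta>" "f (y + t *\<^sub>R u + t *\<^sub>R v) - f (y + t *\<^sub>R u) - f (y + t *\<^sub>R v) + f y = t\<^sup>2 * dd (\<lambda>z. dd f z u) p v"
    using second_difference_mvt[OF t t'(1) \<delta>(2) df] by blast
  obtain q where q: "q \<in> ball y \<delta>" "f (y + t *\<^sub>R v + t *\<^sub>R u) - f (y + t *\<^sub>R v) - f (y + t *\<^sub>R u) + f y = t\<^sup>2 * dd (\<lambda>z. dd f z v) q u"
    using second_difference_mvt[OF t t'(2) \<delta>(2) df] by blast
  have "y + t *\<^sub>R v + t *\<^sub>R u = y + t *\<^sub>R u + t *\<^sub>R v" by simp
  then have "t\<^sup>2 * dd (\<lambda>z. dd f z u) p v = t\<^sup>2 * dd (\<lambda>z. dd f z v) q u"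
    using p(2) q(2) by (simp only:)
  then have "dd (\<lambda>z. dd f z u) p v = dd (\<lambda>z. dd f z v) q u" using t by simp
  moreover have "dist p y < d1" "dist q y < d2" using p(1) q(1) by (auto simp: \<delta>_def dist_commute)
  ultimately show False using d1(2)[of p] d2(2)[of q] e by (simp add: e_def abs_if split: if_splits)
qed

lemma Ck_on_cong:
  assumes "open S" "\<And>z. z \<in> S \<Longrightarrow> g z = h z" "Ck_on k h S"
  shows "Ck_on k g S"
  using assms(2,3)
proof (induction k arbitrary: g h)
  case 0 then show ?case by (simp cong: continuous_on_cong)
next
  case (Suc k)
  have d: "g differentiable (at z)" "dd g z = dd h z" if "z \<in> S" for z
    using Suc.prems differentiable_cong_open[OF assms(1) that, of g h] dd_cong_open[OF assms(1) that, of g h] that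
    by auto
  have "Ck_on k (\<lambda>z. dd g z v) S" for v
    by (rule Suc.IH[of _ "\<lambda>z. dd h z v"]) (use d Suc.prems(2) in auto)
  then show ?case using d by simp
qed

lemma smooth_on_inner:
  assumes S: "open S" and f: "smooth_on S f"
  shows "smooth_on S (\<lambda>z. f z \<bullet> b)"
proof -
  have "Ck_on k (\<lambda>z. f z \<bullet> b) S" if "smooth_on S f" for k f
    using that
  proof (induction k arbitrary: f)
    case 0
    then show ?case using smooth_on_continuous by (auto intro!: continuous_intros)
  next
    case (Suc k)
    have "(\<lambda>z. f z \<bullet> b) differentiable (at z)" if "z \<in> S" for z
      using differentiable_bounded_linear[OF bounded_linear_inner_left smooth_on_differentiable[OF Suc.prems that]] .
    moreover have "Ck_on k (\<lambda>z. dd (\<lambda>z. f z \<bullet> b) z v) S" for v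
      by (rule Ck_on_cong[OF S _ Suc.IH[OF smooth_on_dd[OF Suc.prems]]])
         (rule dd_bounded_linear[OF bounded_linear_inner_left smooth_on_differentiable[OF Suc.prems]])
    ultimately show ?case by simp
  qed
  then show ?thesis using f by (auto simp: smooth_on_def)
qed

lemma second_derivative_symmetric:
  fixes f :: "'a::euclidean_space \<Rightarrow> 'b::euclidean_space"
  assumes S: "open S" "y \<in> S" and f: "smooth_on S f"
  shows "dd (\<lambda>z. dd f z u) y v = dd (\<lambda>z. dd f z v) y u"
proof (rule euclidean_eqI)
  fix b :: 'b
  have 1: "dd (\<lambda>z. dd (\<lambda>z. f z \<bullet> b) z u) y v = dd (\<lambda>z. dd f z u) y v \<bullet> b" for u v
  proof -
    have "dd (\<lambda>z. f z \<bullet> b) z u = dd f z u \<bullet> b" if "z \<in> S" for z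
      using dd_bounded_linear[OF bounded_linear_inner_left smooth_on_differentiable[OF f that]] .
    then have "dd (\<lambda>z. dd (\<lambda>z. f z \<bullet> b) z u) y = dd (\<lambda>z. dd f z u \<bullet> b) y"
      by (intro dd_cong_open[OF S] differentiable_bounded_linear[OF bounded_linear_inner_left]
            smooth_on_differentiable[OF smooth_on_dd[OF f] S(2)])
    then show ?thesis
      using dd_bounded_linear[OF bounded_linear_inner_left smooth_on_differentiable[OF smooth_on_dd[OF f] S(2)]] by simp
  qed
  show "dd (\<lambda>z. dd f z u) y v \<bullet> b = dd (\<lambda>z. dd f z v) y u \<bullet> b"
    using second_derivative_symmetric_real[OF S smooth_on_inner[OF S(1) f], of b u v] by (simp add: 1)
qed

section \<open>Differentiability of determinants and inverse matrices\<close>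

lemma differentiable_prod:
  fixes f :: "'i \<Rightarrow> 'a::real_normed_vector \<Rightarrow> real"
  assumes "\<And>i. i \<in> I \<Longrightarrow> f i differentiable (at y)"
  shows "(\<lambda>z. \<Prod>i\<in>I. f i z) differentiable (at y)"
  using assms by (induction I rule: infinite_finite_induct) auto

lemma differentiable_vec:
  fixes f :: "'a::real_normed_vector \<Rightarrow> 'b::euclidean_space ^ 'n"
  assumes "\<And>i. (\<lambda>z. f z $ i) differentiable (at y)"
  shows "f differentiable (at y)"
proof -
  have "((\<lambda>z. \<Sum>i\<in>UNIV. axis i (f z $ i)) has_derivative (\<lambda>h. \<Sum>i\<in>UNIV. axis i (dd (\<lambda>z. f z $ i) y h))) (at y)"
  proof (intro has_derivative_sum bounded_linear.has_derivative[OF _ dd_works[OF assms]])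
    have "linear (axis i :: 'b \<Rightarrow> 'b^'n)" for i
      by (rule linearI) (auto simp: vec_eq_iff axis_def)
    then show "bounded_linear (axis i :: 'b \<Rightarrow> 'b^'n)" for i
      by (simp add: linear_conv_bounded_linear)
  qed
  moreover have "(\<Sum>i\<in>UNIV. axis i (f z $ i)) = f z" for z
    by (simp add: vec_eq_iff axis_def)
  ultimately show ?thesis by (auto simp: differentiable_def)
qed

lemma differentiable_nth:
  fixes f :: "'a::real_normed_vector \<Rightarrow> 'b::euclidean_space ^ 'n"
  shows "f differentiable (at y) \<Longrightarrow> (\<lambda>z. f z $ i) differentiable (at y)"
  by (rule differentiable_bounded_linear[OF bounded_linear_vec_nth])

lemma differentiable_det:
  fixes A :: "'a::real_normed_vector \<Rightarrow> real^'n^'n"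
  assumes "A differentiable (at y)"
  shows "(\<lambda>z. det (A z)) differentiable (at y)"
  unfolding det_def
  by (intro differentiable_sum differentiable_mult differentiable_const differentiable_prod
      differentiable_nth assms ballI) (auto simp: finite_permutations)

lemma matrix_inv_mult:
  fixes A :: "'a::semiring_1^'n^'m"
  assumes "invertible A"
  shows "A ** matrix_inv A = mat 1" "matrix_inv A ** A = mat 1"
  using someI_ex[OF assms[unfolded invertible_def]] unfolding matrix_inv_def by auto

text \<open>\<open>matrix_inv\<close> is defined by choice, so differentiability goes through
  Cramer's rule, which expresses the product on \<open>S\<close> by quotients of
  determinants.\<close>

lemma differentiable_matrix_inv_mult:
  fixes A :: "'a::real_normed_vector \<Rightarrow> real^'n^'n"
  assumes S: "open S" "y \<in> S" and inv: "\<And>z. z \<in> S \<Longrightarrow> invertible (A z)"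
    and A: "A differentiable (at y)" and b: "b differentiable (at y)"
  shows "(\<lambda>z. matrix_inv (A z) *v b z) differentiable (at y)"
proof (rule differentiable_cong_open[OF S])
  have det: "det (A z) \<noteq> 0" if "z \<in> S" for z using inv[OF that] invertible_det_nz by blast
  show "matrix_inv (A z) *v b z = (\<chi> k. det(\<chi> i j. if j=k then b z $ i else A z $ i $ j) / det (A z))"
    if "z \<in> S" for z
  proof -
    have "A z *v (matrix_inv (A z) *v b z) = b z"
      using inv[OF that] by (simp add: matrix_vector_mul_assoc matrix_inv_mult(1))
    then show ?thesis using cramer[OF det[OF that]] by blast
  qed
  have "(\<lambda>z. \<chi> i j. if j=k then b z $ i else A z $ i $ j) differentiable (at y)" for k
  proof (intro differentiable_vec, simp)
    show "(\<lambda>z. if j = k then b z $ i else A z $ i $ j) differentiable (at y)" for i j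
      by (cases "j = k") (auto intro!: differentiable_nth A b)
  qed
  then show "(\<lambda>z. \<chi> k. det(\<chi> i j. if j=k then b z $ i else A z $ i $ j) / det (A z)) differentiable (at y)"
    using det[OF S(2)] A by (intro differentiable_vec) (auto intro!: differentiable_divide differentiable_det)
qed

section \<open>The Levi-Civita connection along a map\<close>

definition spd :: "real^'k^'k \<Rightarrow> bool" where
  "spd A \<longleftrightarrow> transpose A = A \<and> (\<forall>v. v \<noteq> 0 \<longrightarrow> ip A v v > 0)"

lemma bilinear_ip: "bilinear (ip A)"
  unfolding bilinear_def ip_def
  by (auto intro!: linearI simp: inner_add_left inner_add_right matrix_vector_right_distrib matrix_vector_mult_scaleR)

lemma ip_linear_simps:
  "ip A (u + v) w = ip A u w + ip A v w" "ip A u (v + w) = ip A u v + ip A u w"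
  "ip A (u - v) w = ip A u w - ip A v w" "ip A u (v - w) = ip A u v - ip A u w"
  "ip A (c *\<^sub>R u) v = c * ip A u v" "ip A u (c *\<^sub>R v) = c * ip A u v"
  "ip A (- u) v = - ip A u v" "ip A u (- v) = - ip A u v"
  "ip A 0 v = 0" "ip A u 0 = 0"
  using bilinear_ip[of A]
  by (simp_all add: bilinear_ladd bilinear_radd bilinear_lsub bilinear_rsub bilinear_lmul bilinear_rmul
      bilinear_lneg bilinear_rneg bilinear_lzero bilinear_rzero)

lemma ip_matrix_linear_simps:
  "ip (A + B) v w = ip A v w + ip B v w" "ip (c *\<^sub>R A) v w = c * ip A v w" "ip (A - B) v w = ip A v w - ip B v w"
  unfolding ip_def by (simp_all add: matrix_vector_mult_add_rdistrib matrix_vector_mult_diff_rdistrib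
      inner_add_right inner_diff_right scaleR_matrix_vector_assoc[symmetric])

lemma ip_sum_left: "ip A (\<Sum>i\<in>I. f i) v = (\<Sum>i\<in>I. ip A (f i) v)"
  using linear_sum[of "\<lambda>u. ip A u v" f I] bilinear_ip[of A] by (auto simp: bilinear_def)

lemma ip_sum_right: "ip A v (\<Sum>i\<in>I. f i) = (\<Sum>i\<in>I. ip A v (f i))"
  using linear_sum[of "ip A v" f I] bilinear_ip[of A] by (auto simp: bilinear_def)

lemma bounded_linear_ip_matrix: "bounded_linear (\<lambda>A. ip A v w)"
  by (intro linear_conv_bounded_linear[THEN iffD1] linearI) (simp_all add: ip_matrix_linear_simps)

lemma ip_transpose: "ip (transpose A) v w = ip A w v"
  unfolding ip_def transpose_matrix_vector by (metis dot_lmul_matrix inner_commute)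

lemma linear_eq_sum_axis:
  fixes \<phi> :: "real^'k \<Rightarrow> 'b::real_vector"
  assumes "linear \<phi>"
  shows "\<phi> l = (\<Sum>i\<in>UNIV. l $ i *\<^sub>R \<phi> (axis i 1))"
proof -
  have "l = (\<Sum>i\<in>UNIV. l $ i *\<^sub>R axis i 1)"
    by (simp add: vec_eq_iff axis_def if_distrib cong: if_cong)
  then have "\<phi> l = \<phi> (\<Sum>i\<in>UNIV. l $ i *\<^sub>R axis i 1)" by simp
  then show ?thesis by (simp add: linear_sum[OF assms] linear_scale[OF assms])
qed

lemma spd_ip_commute: "spd A \<Longrightarrow> ip A v w = ip A w v"
  using ip_transpose[of A v w] by (simp add: spd_def)

lemma spd_ip_eq_0: "spd A \<Longrightarrow> ip A v v = 0 \<longleftrightarrow> v = 0"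
  by (auto simp: spd_def ip_linear_simps dest: less_imp_neq)

lemma spd_eqI:
  assumes "spd A" "\<And>l. ip A v l = ip A w l"
  shows "v = w"
proof -
  have "ip A (v - w) (v - w) = 0" using assms(2) by (simp add: ip_linear_simps)
  then show ?thesis using spd_ip_eq_0[OF assms(1)] by auto
qed

lemma spd_invertible:
  assumes "spd A" shows "invertible A"
proof -
  have "v = 0" if "A *v v = 0" for v
    using spd_ip_eq_0[OF assms, of v] that by (simp add: ip_def)
  then show ?thesis
    using matrix_left_invertible_ker invertible_left_inverse by blast
qed

lemma ip_matrix_inv:
  assumes "spd A" shows "ip A (matrix_inv A *v b) w = b \<bullet> w" "ip A w (matrix_inv A *v b) = b \<bullet> w"
proof -
  show "ip A w (matrix_inv A *v b) = b \<bullet> w"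
    using matrix_inv_mult(1)[OF spd_invertible[OF assms]]
    by (simp add: ip_def matrix_vector_mul_assoc inner_commute)
  then show "ip A (matrix_inv A *v b) w = b \<bullet> w" using spd_ip_commute[OF assms] by metis
qed

lemma spd_matrix_inv_symmetric:
  assumes "spd A" shows "matrix_inv A $ i $ j = matrix_inv A $ j $ i"
proof -
  have e: "axis i 1 \<bullet> (matrix_inv A *v axis j 1) = matrix_inv A $ i $ j" for i j
    by (simp add: inner_axis' matrix_vector_mult_basis column_def)
  have "ip A (matrix_inv A *v axis i 1) (matrix_inv A *v axis j 1) = ip A (matrix_inv A *v axis j 1) (matrix_inv A *v axis i 1)"
    by (rule spd_ip_commute[OF assms])
  then show ?thesis unfolding ip_matrix_inv[OF assms] e by (rule sym)
qed

text \<open>Asks for two derivatives of \<open>G\<close>, which is what curvature involves, instead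
  of \<open>smooth_on\<close>: the induced metric has to satisfy the same assumptions, and for it
  two derivatives follow from the product rule.\<close>

locale metric_domain =
  fixes E :: "(real^'m) set" and G :: "'m metric"
  assumes open_E: "open E" and spd_G: "\<And>z. z \<in> E \<Longrightarrow> spd (G z)"
    and G_diff: "\<And>z. z \<in> E \<Longrightarrow> G differentiable (at z)"
    and dG_diff: "\<And>z v. z \<in> E \<Longrightarrow> (\<lambda>z. dd G z v) differentiable (at z)"
begin

lemma dd_ip: "z \<in> E \<Longrightarrow> dd (\<lambda>z. ip (G z) v w) z u = ip (dd G z u) v w"
  by (rule dd_bounded_linear[OF bounded_linear_ip_matrix G_diff])

lemma linear_dd_G: "z \<in> E \<Longrightarrow> linear (dd G z)"
  by (rule linear_frechet_derivative[OF G_diff])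

lemma ip_dd_commute:
  assumes "z \<in> E" shows "ip (dd G z u) v w = ip (dd G z u) w v"
proof -
  have "dd (\<lambda>z. ip (G z) v w) z = dd (\<lambda>z. ip (G z) w v) z"
    by (rule dd_cong_open[OF open_E assms])
       (auto simp: spd_ip_commute[OF spd_G] intro!: differentiable_bounded_linear[OF bounded_linear_ip_matrix]
          G_diff assms)
  then show ?thesis by (simp add: dd_ip[OF assms, symmetric])
qed

lemma ip_dd_linear_simps:
  assumes "z \<in> E"
  shows "ip (dd G z (u + u')) v w = ip (dd G z u) v w + ip (dd G z u') v w"
    "ip (dd G z (c *\<^sub>R u)) v w = c * ip (dd G z u) v w"
  by (simp_all add: linear_add[OF linear_dd_G[OF assms]] linear_scale[OF linear_dd_G[OF assms]] ip_matrix_linear_simps)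

text \<open>By linearity in \<open>l\<close> the components in the definition extend to all vectors.
  Identities for the connection can then be tested against every \<open>l\<close> by
  \<open>spd_eqI\<close>, and the inverse matrix disappears.\<close>

lemma koszul:
  assumes z: "z \<in> E"
  shows "ip (G z) (christoffel G z v w) l
    = (ip (dd G z v) w l + ip (dd G z w) v l - ip (dd G z l) v w) / 2"
proof -
  define \<phi> where "\<phi> l = (ip (dd G z v) w l + ip (dd G z w) v l - ip (dd G z l) v w) / 2" for l
  have "linear \<phi>" unfolding \<phi>_def
    by (rule linearI) (simp_all add: ip_linear_simps ip_dd_linear_simps[OF z] algebra_simps add_divide_distrib diff_divide_distrib)
  have "christoffel G z v w = matrix_inv (G z) *v (\<chi> i. \<phi> (axis i 1))"
    unfolding christoffel_def \<phi>_def dd_ip[OF z] ..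
  then have "ip (G z) (christoffel G z v w) l = (\<chi> i. \<phi> (axis i 1)) \<bullet> l"
    by (simp add: ip_matrix_inv[OF spd_G[OF z]])
  also have "\<dots> = \<phi> l"
    by (subst linear_eq_sum_axis[OF \<open>linear \<phi>\<close>, of l]) (simp add: inner_vec_def mult.commute)
  finally show ?thesis by (simp add: \<phi>_def)
qed

lemma christoffel_commute: "z \<in> E \<Longrightarrow> christoffel G z v w = christoffel G z w v"
  by (rule spd_eqI[OF spd_G]) (auto simp: koszul ip_dd_commute)

lemma bilinear_christoffel:
  assumes z: "z \<in> E" shows "bilinear (christoffel G z)"
proof -
  have 1: "linear (christoffel G z v)" for v
    by (rule linearI; rule spd_eqI[OF spd_G[OF z]])
       (simp_all add: koszul z ip_linear_simps ip_dd_linear_simps field_simps)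
  then show ?thesis unfolding bilinear_def using christoffel_commute[OF z] by (metis (no_types, lifting) ext)
qed

text \<open>Metric compatibility: in the sum of the two Koszul expressions the derivatives in the
  directions \<open>v\<close> and \<open>w\<close> cancel.\<close>

lemma christoffel_metric:
  assumes z: "z \<in> E"
  shows "ip (G z) (christoffel G z u v) w + ip (G z) v (christoffel G z u w) = ip (dd G z u) v w"
  unfolding spd_ip_commute[OF spd_G[OF z], of v] koszul[OF z]
  using ip_dd_commute[OF z, of u v w] ip_dd_commute[OF z, of w u v] ip_dd_commute[OF z, of v u w]
  by (simp add: field_simps)

lemma differentiable_christoffel:
  assumes z: "z \<in> E" shows "(\<lambda>z. christoffel G z v w) differentiable (at z)"
proof (rule differentiable_cong_open[OF open_E z])
  let ?b = "\<lambda>z. (\<chi> l. (ip (dd G z v) w (axis l 1) + ip (dd G z w) v (axis l 1) - ip (dd G z (axis l 1)) v w) / 2)"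
  show "christoffel G y v w = matrix_inv (G y) *v ?b y" if "y \<in> E" for y
    unfolding christoffel_def dd_ip[OF that] ..
  have d: "(\<lambda>z. ip (dd G z a) b c) differentiable (at z)" for a b c
    by (rule differentiable_bounded_linear[OF bounded_linear_ip_matrix dG_diff[OF z]])
  have "?b differentiable (at z)"
    by (rule differentiable_vec) (auto intro!: differentiable_divide differentiable_diff differentiable_add d)
  then show "(\<lambda>z. matrix_inv (G z) *v ?b z) differentiable (at z)"
    by (intro differentiable_matrix_inv_mult[OF open_E z] spd_invertible spd_G G_diff[OF z])
qed

end

section \<open>The connection pulled back along a map\<close>

locale map_into_metric = metric_domain E G
  for E :: "(real^'m) set" and G :: "'m metric" +
  fixes D :: "(real^'n) set" and F :: "real^'n \<Rightarrow> real^'m"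
  assumes open_D: "open D" and smooth_F: "smooth_on D F" and F_into: "\<And>z. z \<in> D \<Longrightarrow> F z \<in> E"
begin

lemma F_diff: "y \<in> D \<Longrightarrow> F differentiable (at y)"
  by (rule smooth_on_differentiable[OF smooth_F])

lemma dF_diff: "y \<in> D \<Longrightarrow> (\<lambda>z. dd F z v) differentiable (at y)"
  by (rule smooth_on_differentiable[OF smooth_on_dd[OF smooth_F]])

lemma linear_dF: "y \<in> D \<Longrightarrow> linear (dd F y)"
  by (rule linear_frechet_derivative[OF F_diff])

lemma has_derivative_dF_apply:
  assumes "y \<in> D" "X differentiable (at y)"
  shows "((\<lambda>z. dd F z (X z)) has_derivative (\<lambda>h. dd (\<lambda>z. dd F z (X y)) y h + dd F y (dd X y h))) (at y)"
  by (rule has_derivative_linear_apply[OF open_D assms(1) linear_dF dF_diff[OF assms(1)] assms(2)])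

lemma differentiable_ip_along:
  assumes y: "y \<in> D" shows "(\<lambda>z. ip (G (F z)) v w) differentiable (at y)"
  by (rule differentiable_bounded_linear[OF bounded_linear_ip_matrix])
     (rule has_derivative_differentiable[OF has_derivative_compose[OF dd_works[OF F_diff[OF y]]
        dd_works[OF G_diff[OF F_into[OF y]]]]])

lemma dd_ip_along:
  assumes y: "y \<in> D" shows "dd (\<lambda>z. ip (G (F z)) v w) y u = ip (dd G (F y) (dd F y u)) v w"
  using dd_compose[OF F_diff[OF y], of "\<lambda>z. ip (G z) v w" u] dd_ip[OF F_into[OF y]]
    differentiable_bounded_linear[OF bounded_linear_ip_matrix G_diff[OF F_into[OF y]]]
  by simp

text \<open>Metric compatibility of the pulled-back connection: \<open>christoffel_metric\<close>
  shares the derivative of the metric between the two fields.\<close>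

lemma has_derivative_ip_along:
  assumes y: "y \<in> D" and W: "W1 differentiable (at y)" "W2 differentiable (at y)"
  shows "((\<lambda>z. ip (G (F z)) (W1 z) (W2 z)) has_derivative
    (\<lambda>v. ip (G (F y)) (cov_along G F v W1 y) (W2 y) + ip (G (F y)) (W1 y) (cov_along G F v W2 y))) (at y)"
proof -
  have "((\<lambda>z. ip (G (F z)) (W1 z) (W2 z)) has_derivative
    (\<lambda>v. dd (\<lambda>z. ip (G (F z)) (W1 y) (W2 y)) y v + ip (G (F y)) (dd W1 y v) (W2 y) + ip (G (F y)) (W1 y) (dd W2 y v))) (at y)"
    by (rule has_derivative_bilinear_apply[OF open_D y bilinear_ip differentiable_ip_along[OF y] W])
  then show ?thesis
    by (simp add: dd_ip_along[OF y] christoffel_metric[OF F_into[OF y], symmetric] cov_along_def ip_linear_simps algebra_simps)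
qed

lemma dd_ip_fields:
  assumes y: "y \<in> D" and W: "W1 differentiable (at y)" "W2 differentiable (at y)"
  shows "dd (\<lambda>z. ip (G (F z)) (W1 z) (W2 z)) y v =
     ip (G (F y)) (cov_along G F v W1 y) (W2 y) + ip (G (F y)) (W1 y) (cov_along G F v W2 y)"
  by (simp add: dd_eqI[OF has_derivative_ip_along[OF assms]])

text \<open>Vanishing torsion, from the symmetry of the second derivatives of \<open>F\<close> and
  of the Christoffel form.\<close>

lemma cov_along_dF_commute:
  assumes y: "y \<in> D"
  shows "cov_along G F v (\<lambda>z. dd F z w) y = cov_along G F w (\<lambda>z. dd F z v) y"
  unfolding cov_along_def
  using second_derivative_symmetric[OF open_D y smooth_F] christoffel_commute[OF F_into[OF y]] by metis

lemma has_derivative_christoffel_along: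
  assumes y: "y \<in> D" and W: "W1 differentiable (at y)" "W2 differentiable (at y)"
  shows "((\<lambda>z. christoffel G (F z) (W1 z) (W2 z)) has_derivative
    (\<lambda>u. dd (\<lambda>x. christoffel G x (W1 y) (W2 y)) (F y) (dd F y u)
      + christoffel G (F y) (dd W1 y u) (W2 y) + christoffel G (F y) (W1 y) (dd W2 y u))) (at y)"
proof -
  have d: "(\<lambda>z. christoffel G (F z) v w) differentiable (at y)" for v w
    by (rule has_derivative_differentiable[OF has_derivative_compose[OF dd_works[OF F_diff[OF y]]
        dd_works[OF differentiable_christoffel[OF F_into[OF y]]]]])
  show ?thesis
    using has_derivative_bilinear_apply[OF open_D y bilinear_christoffel[OF F_into] d W]
    by (simp add: dd_compose[OF F_diff[OF y] differentiable_christoffel[OF F_into[OF y]]])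
qed

lemma has_derivative_cov_along:
  assumes y: "y \<in> D" and W: "W differentiable (at y)" "(\<lambda>z. dd W z v) differentiable (at y)"
  shows "((cov_along G F v W) has_derivative
    (\<lambda>u. dd (\<lambda>z. dd W z v) y u + (dd (\<lambda>x. christoffel G x (dd F y v) (W y)) (F y) (dd F y u)
      + christoffel G (F y) (dd (\<lambda>z. dd F z v) y u) (W y) + christoffel G (F y) (dd F y v) (dd W y u)))) (at y)"
  unfolding cov_along_def
  by (intro has_derivative_add dd_works W(2) has_derivative_christoffel_along[OF y dF_diff[OF y] W(1)])

text \<open>Constant \<open>u\<close> and \<open>v\<close> commute, so no bracket term arises. The
  second derivatives of \<open>W\<close> and of \<open>F\<close> are symmetric and drop out, which
  leaves the ambient curvature. The set \<open>U\<close> admits fields that are smooth only near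
  \<open>y\<close>.\<close>

lemma cov_along_curvature:
  assumes U: "open U" "y \<in> U" "U \<subseteq> D" and W: "smooth_on U W"
  shows "cov_along G F u (cov_along G F v W) y - cov_along G F v (cov_along G F u W) y
     = curvature G (F y) (dd F y u) (dd F y v) (W y)"
proof -
  have y: "y \<in> D" using U by auto
  note dW = smooth_on_differentiable[OF W U(2)] smooth_on_differentiable[OF smooth_on_dd[OF W] U(2)]
  have \<Gamma>: "christoffel G (F y) a (b + c) = christoffel G (F y) a b + christoffel G (F y) a c" for a b c
    using bilinear_christoffel[OF F_into[OF y]] by (auto simp: bilinear_def linear_add)
  have "dd (\<lambda>z. dd W z u) y v = dd (\<lambda>z. dd W z v) y u"
    by (rule second_derivative_symmetric[OF U(1,2) W])
  moreover have "dd (\<lambda>z. dd F z u) y v = dd (\<lambda>z. dd F z v) y u"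
    by (rule second_derivative_symmetric[OF open_D y smooth_F])
  ultimately show ?thesis
    unfolding cov_along_def[of G F _ "cov_along G F _ W"] dd_eqI[OF has_derivative_cov_along[OF y dW]]
    by (simp add: cov_along_def curvature_def \<Gamma>)
qed

end

section \<open>Curvature of conformally flat metrics\<close>

lemma orthonormal_family_expand:
  fixes A :: "real^'k^'k"
  assumes e: "orthonormal_family A CARD('k) e" and A: "spd A"
  shows "v = (\<Sum>k\<in>{1..CARD('k)}. ip A v (e k) *\<^sub>R e k)"
proof -
  let ?I = "{1..CARD('k)}"
  have ee: "ip A (e i) (e j) = (if i = j then 1 else 0)" if "i \<in> ?I" "j \<in> ?I" for i j
    using e that unfolding orthonormal_family_def by blast
  have coeff: "ip A (\<Sum>k\<in>?I. c k *\<^sub>R e k) (e j) = c j" if "j \<in> ?I" for c j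
  proof -
    have "ip A (\<Sum>k\<in>?I. c k *\<^sub>R e k) (e j) = (\<Sum>k\<in>?I. if k = j then c k else 0)"
      unfolding ip_sum_left by (intro sum.cong refl) (use ee that in \<open>auto simp: ip_linear_simps\<close>)
    then show ?thesis using that by simp
  qed
  have inj: "inj_on e ?I"
  proof (rule inj_onI)
    fix i j assume ij: "i \<in> ?I" "j \<in> ?I" "e i = e j"
    then show "i = j" using ee[OF ij(1,1)] ee[OF ij(1,2)] by (auto split: if_splits)
  qed
  have "independent (e ` ?I)"
  proof (rule independent_if_scalars_zero)
    fix f x assume s: "(\<Sum>x\<in>e ` ?I. f x *\<^sub>R x) = 0" and "x \<in> e ` ?I"
    then obtain j where j: "j \<in> ?I" "x = e j" by blast
    have "(\<Sum>k\<in>?I. f (e k) *\<^sub>R e k) = 0" using s unfolding sum.reindex[OF inj] o_def .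
    then show "f x = 0" using coeff[OF j(1), of "\<lambda>k. f (e k)"] j by (simp add: ip_linear_simps)
  qed simp
  moreover have "card (e ` ?I) = CARD('k)" using card_image[OF inj] by simp
  ultimately have "span (e ` ?I) = UNIV"
    using independent_card_le_dim card_ge_dim_independent[of "e ` ?I" UNIV] by (simp add: dim_UNIV) auto
  then have "v \<in> span (e ` ?I)" by simp
  then obtain c where "v = (\<Sum>x\<in>e ` ?I. c x *\<^sub>R x)" by (auto simp: span_finite)
  then have v: "v = (\<Sum>k\<in>?I. c (e k) *\<^sub>R e k)" unfolding sum.reindex[OF inj] o_def .
  have "ip A v (e k) = c (e k)" if "k \<in> ?I" for k
    using coeff[OF that, of "\<lambda>k. c (e k)"] v by simp
  then have "(\<Sum>k\<in>?I. c (e k) *\<^sub>R e k) = (\<Sum>k\<in>?I. ip A v (e k) *\<^sub>R e k)"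
    by (intro sum.cong refl) metis
  with v show ?thesis by (rule trans)
qed

lemma orthonormal_family_parseval:
  fixes A :: "real^'k^'k"
  assumes e: "orthonormal_family A CARD('k) e" and A: "spd A"
  shows "ip A v w = (\<Sum>k\<in>{1..CARD('k)}. ip A v (e k) * ip A w (e k))"
proof -
  have "ip A v w = ip A (\<Sum>k\<in>{1..CARD('k)}. ip A v (e k) *\<^sub>R e k) w"
    using orthonormal_family_expand[OF assms, of v] by simp
  then show ?thesis by (simp add: ip_sum_left ip_linear_simps spd_ip_commute[OF A, of w])
qed

lemma metric_trace_eq_axis:
  fixes A :: "real^'k^'k" and B :: "real^'k \<Rightarrow> real^'k \<Rightarrow> 'b::real_vector"
  assumes A: "spd A" and B: "bilinear B"
  shows "metric_trace A B = (\<Sum>i\<in>UNIV. B (axis i 1) (matrix_inv A *v axis i 1))"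
  unfolding metric_trace_def
proof (intro sum.cong refl)
  fix i :: 'k
  have l: "linear (B (axis i 1))" using B by (simp add: bilinear_def)
  have "B (axis i 1) (matrix_inv A *v axis i 1) =
      (\<Sum>j\<in>UNIV. (matrix_inv A *v axis i 1) $ j *\<^sub>R B (axis i 1) (axis j 1))"
    by (rule linear_eq_sum_axis[OF l])
  also have "\<dots> = (\<Sum>j\<in>UNIV. matrix_inv A $ i $ j *\<^sub>R B (axis i 1) (axis j 1))"
    by (simp add: matrix_vector_mult_basis column_def spd_matrix_inv_symmetric[OF A, of i])
  finally show "(\<Sum>j\<in>UNIV. matrix_inv A $ i $ j *\<^sub>R B (axis i 1) (axis j 1)) = B (axis i 1) (matrix_inv A *v axis i 1)" ..
qed

text \<open>Expanding the left slot in the frame leaves \<open>matrix_inv A *v (A *v e k)\<close>,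
  that is \<open>e k\<close>, in the right one.\<close>

lemma metric_trace_orthonormal:
  fixes A :: "real^'k^'k" and B :: "real^'k \<Rightarrow> real^'k \<Rightarrow> 'b::real_vector"
  assumes A: "spd A" and e: "orthonormal_family A CARD('k) e" and B: "bilinear B"
  shows "metric_trace A B = (\<Sum>k\<in>{1..CARD('k)}. B (e k) (e k))"
proof -
  let ?I = "{1..CARD('k)}" and ?x = "\<lambda>i. matrix_inv A *v axis i (1::real)"
  have l: "linear (B v)" "linear (\<lambda>v. B v w)" for v w using B by (auto simp: bilinear_def)
  have "metric_trace A B = (\<Sum>i\<in>UNIV. B (\<Sum>k\<in>?I. ip A (axis i 1) (e k) *\<^sub>R e k) (?x i))"
    unfolding metric_trace_eq_axis[OF A B] using orthonormal_family_expand[OF e A] by simp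
  also have "\<dots> = (\<Sum>i\<in>UNIV. \<Sum>k\<in>?I. ip A (axis i 1) (e k) *\<^sub>R B (e k) (?x i))"
    by (simp add: linear_sum[OF l(2)] linear_scale[OF l(2)])
  also have "\<dots> = (\<Sum>k\<in>?I. \<Sum>i\<in>UNIV. ip A (axis i 1) (e k) *\<^sub>R B (e k) (?x i))" by (rule sum.swap)
  also have "\<dots> = (\<Sum>k\<in>?I. B (e k) (e k))"
  proof (intro sum.cong refl)
    fix k
    have "linear (\<lambda>v. B (e k) (matrix_inv A *v v))"
      using linear_compose[OF matrix_vector_mul_linear[of "matrix_inv A"] l(1)[of "e k"]] by (simp add: o_def)
    from linear_eq_sum_axis[OF this, of "A *v e k"]
    have "B (e k) (matrix_inv A *v (A *v e k)) = (\<Sum>i\<in>UNIV. ip A (axis i 1) (e k) *\<^sub>R B (e k) (?x i))"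
      by (simp add: ip_def inner_axis')
    then show "(\<Sum>i\<in>UNIV. ip A (axis i 1) (e k) *\<^sub>R B (e k) (?x i)) = B (e k) (e k)"
      by (simp add: matrix_vector_mul_assoc matrix_inv_mult(2)[OF spd_invertible[OF A]])
  qed
  finally show ?thesis .
qed

text \<open>Satisfied by the curvature \<open>R\<close> of a conformally flat metric, with \<open>S\<close> its Schouten endomorphism.\<close>
definition schouten_form :: "real^'k^'k \<Rightarrow> (real^'k \<Rightarrow> real^'k) \<Rightarrow> (real^'k \<Rightarrow> real^'k \<Rightarrow> real^'k \<Rightarrow> real^'k) \<Rightarrow> bool" where
  "schouten_form A S R \<longleftrightarrow> linear S \<and> (\<forall>v w. ip A (S v) w = ip A (S w) v) \<and>
     (\<forall>u v w. R u v w = ip A (S v) w *\<^sub>R u - ip A (S u) w *\<^sub>R v + ip A v w *\<^sub>R S u - ip A u w *\<^sub>R S v)"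

text \<open>In the trace over \<open>u\<close> the first term gives the dimension and the third the
  trace of \<open>S\<close>; the second and the fourth each remove one copy of
  \<open>ip (G y) (S v) w\<close>, whence the 2.\<close>

lemma ricci_schouten:
  fixes G :: "'k::finite metric"
  assumes "schouten_form (G y) S (curvature G y)"
  shows "ricci G y v w = (real CARD('k) - 2) * ip (G y) (S v) w + (\<Sum>i\<in>UNIV. S (axis i 1) $ i) * ip (G y) v w"
proof -
  have S: "linear S" using assms by (simp add: schouten_form_def)
  have l1: "linear (\<lambda>x. ip (G y) (S x) w)" "linear (\<lambda>x. ip (G y) x w)"
    using S by (auto intro!: linearI simp: ip_linear_simps linear_add linear_scale)
  have "ricci G y v w = (\<Sum>i\<in>UNIV. ip (G y) (S v) w - v $ i *\<^sub>R ip (G y) (S (axis i 1)) w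
     + ip (G y) v w * S (axis i 1) $ i - S v $ i *\<^sub>R ip (G y) (axis i 1) w)"
    unfolding ricci_def using assms by (simp add: schouten_form_def mult.commute)
  also have "\<dots> = real CARD('k) * ip (G y) (S v) w - (\<Sum>i\<in>UNIV. v $ i *\<^sub>R ip (G y) (S (axis i 1)) w)
     + ip (G y) v w * (\<Sum>i\<in>UNIV. S (axis i 1) $ i) - (\<Sum>i\<in>UNIV. S v $ i *\<^sub>R ip (G y) (axis i 1) w)"
    by (simp add: sum.distrib sum_subtractf sum_distrib_left)
  also have "\<dots> = real CARD('k) * ip (G y) (S v) w - ip (G y) (S v) w
     + ip (G y) v w * (\<Sum>i\<in>UNIV. S (axis i 1) $ i) - ip (G y) (S v) w"
    using linear_eq_sum_axis[OF l1(1), of v] linear_eq_sum_axis[OF l1(2), of "S v"] by simp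
  finally show ?thesis by (simp add: algebra_simps)
qed

lemma half_scalar_schouten:
  fixes G :: "'k::finite metric"
  assumes S: "schouten_form (G y) S (curvature G y)" and spd: "spd (G y)"
  shows "half_scalar_curvature G y = (real CARD('k) - 1) * (\<Sum>i\<in>UNIV. S (axis i 1) $ i)"
proof -
  have lin: "linear S" using S by (simp add: schouten_form_def)
  define r where "r = (\<Sum>i\<in>UNIV. S (axis i 1) $ i)"
  have R: "ricci G y = (\<lambda>v w. (real CARD('k) - 2) * ip (G y) (S v) w + r * ip (G y) v w)"
    unfolding r_def using ricci_schouten[OF S] by blast
  have "bilinear (ricci G y)" unfolding R bilinear_def
    using lin by (auto intro!: linearI simp: ip_linear_simps linear_add linear_scale algebra_simps)
  from metric_trace_eq_axis[OF spd this] have "metric_trace (G y) (ricci G y) = (real CARD('k) - 2) * r + r * real CARD('k)"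
    by (simp add: R ip_matrix_inv[OF spd] inner_axis' sum.distrib sum_distrib_left r_def mult.commute)
  then show ?thesis unfolding half_scalar_curvature_def r_def[symmetric] by (simp add: field_simps)
qed

section \<open>Conformal change of a metric\<close>

context metric_domain
begin

definition grad :: "(real^'m \<Rightarrow> real) \<Rightarrow> real^'m \<Rightarrow> real^'m" where
  "grad \<phi> z = matrix_inv (G z) *v (\<chi> i. dd \<phi> z (axis i 1))"

lemma ip_grad:
  assumes "z \<in> E" "\<phi> differentiable (at z)"
  shows "ip (G z) (grad \<phi> z) l = dd \<phi> z l"
  unfolding grad_def ip_matrix_inv[OF spd_G[OF assms(1)]]
  by (subst linear_eq_sum_axis[OF linear_frechet_derivative[OF assms(2)], of l])
     (simp add: inner_vec_def mult.commute)

lemma differentiable_grad: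
  assumes "z \<in> E" "\<And>v. (\<lambda>z. dd \<phi> z v) differentiable (at z)"
  shows "grad \<phi> differentiable (at z)"
  unfolding grad_def
  by (intro differentiable_matrix_inv_mult[OF open_E] spd_invertible spd_G G_diff differentiable_vec assms)
     (simp_all add: assms)

lemma christoffel_conformal:
  assumes z: "z \<in> E" and \<phi>: "\<phi> differentiable (at z)"
  shows "christoffel (\<lambda>z. exp (2 * \<phi> z) *\<^sub>R G z) z v w =
    christoffel G z v w + dd \<phi> z v *\<^sub>R w + dd \<phi> z w *\<^sub>R v - ip (G z) v w *\<^sub>R grad \<phi> z"
proof -
  let ?G = "\<lambda>z. exp (2 * \<phi> z) *\<^sub>R G z" and ?c = "exp (2 * \<phi> z)"
  have der: "(?G has_derivative (\<lambda>u. (2 * dd \<phi> z u * ?c) *\<^sub>R G z + ?c *\<^sub>R dd G z u)) (at z)"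
  proof -
    have "((\<lambda>z. exp (2 * \<phi> z)) has_derivative (\<lambda>u. 2 * dd \<phi> z u * ?c)) (at z)"
      by (rule derivative_eq_intros dd_works[OF \<phi>] refl)+ (simp add: mult_ac)
    from has_derivative_scaleR[OF this dd_works[OF G_diff[OF z]]] show ?thesis by (simp add: add.commute)
  qed
  have spd: "spd (?G z)" using spd_G[OF z] by (simp add: spd_def transpose_scalar ip_matrix_linear_simps)
  have ddip: "dd (\<lambda>z. ip (?G z) a b) z u = (2 * dd \<phi> z u * ?c) * ip (G z) a b + ?c * ip (dd G z u) a b" for a b u
    using dd_bounded_linear[OF bounded_linear_ip_matrix has_derivative_differentiable[OF der], of a b u]
    by (simp add: dd_eqI[OF der] ip_matrix_linear_simps)
  \<comment> \<open>The Koszul expression of the conformal metric with the common factor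
    \<open>?c\<close> taken out. As in \<open>koszul\<close>, its linearity lets the components on
    \<open>axis\<close> determine it.\<close>
  define \<Psi> where "\<Psi> l = (2 * dd \<phi> z v * ip (G z) w l + ip (dd G z v) w l + 2 * dd \<phi> z w * ip (G z) v l + ip (dd G z w) v l
     - 2 * dd \<phi> z l * ip (G z) v w - ip (dd G z l) v w) / 2" for l
  have lin: "linear \<Psi>" unfolding \<Psi>_def
    by (rule linearI)
       (simp_all add: ip_linear_simps ip_dd_linear_simps[OF z] linear_add[OF linear_frechet_derivative[OF \<phi>]]
         linear_scale[OF linear_frechet_derivative[OF \<phi>]] field_simps)
  have chr: "christoffel ?G z v w = matrix_inv (?G z) *v (\<chi> i. ?c * \<Psi> (axis i 1))"
    unfolding christoffel_def ddip by (rule arg_cong[where f = "\<lambda>b. _ *v b"]) (simp add: vec_eq_iff \<Psi>_def field_simps)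
  show ?thesis
  proof (rule spd_eqI[OF spd])
    fix l
    have "ip (?G z) (christoffel ?G z v w) l = ?c * \<Psi> l"
      unfolding chr ip_matrix_inv[OF spd]
      by (subst linear_eq_sum_axis[OF lin, of l]) (simp add: inner_vec_def mult_ac sum_distrib_left)
    also have "\<dots> = ip (?G z) (christoffel G z v w + dd \<phi> z v *\<^sub>R w + dd \<phi> z w *\<^sub>R v - ip (G z) v w *\<^sub>R grad \<phi> z) l"
      by (simp add: ip_matrix_linear_simps ip_linear_simps koszul[OF z] ip_grad[OF z \<phi>] \<Psi>_def field_simps)
    finally show "ip (?G z) (christoffel ?G z v w) l =
      ip (?G z) (christoffel G z v w + dd \<phi> z v *\<^sub>R w + dd \<phi> z w *\<^sub>R v - ip (G z) v w *\<^sub>R grad \<phi> z) l" .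
  qed
qed

text \<open>The witness is the Hessian of \<open>\<phi>\<close>, minus the square of its
  differential, plus half the squared norm of its gradient times the metric, with an index raised by
  \<open>G y\<close>. Under the conformal change the curvature loses exactly the Kulkarni-Nomizu
  expression in this tensor, so flatness of the new metric identifies the old curvature with
  it.\<close>

lemma schouten_form_conformally_flat:
  assumes y: "y \<in> E" and \<phi>: "smooth_on E \<phi>"
    and flat: "\<And>u v w. curvature (\<lambda>z. exp (2 * \<phi> z) *\<^sub>R G z) y u v w = 0"
  shows "\<exists>S. schouten_form (G y) S (curvature G y)"
proof -
  note d\<phi> = smooth_on_differentiable[OF \<phi>] and dd\<phi> = smooth_on_differentiable[OF smooth_on_dd[OF \<phi>]]
  let ?n = "grad \<phi>" and ?\<Gamma> = "christoffel G y"
  define a where "a = dd \<phi> y"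
  define N where "N = ?n y"
  define k where "k = ip (G y) N N / 2"
  define h where "h u v = dd (\<lambda>z. dd \<phi> z v) y u" for u v
  define S where "S u = dd ?n y u + ?\<Gamma> u N - a u *\<^sub>R N + k *\<^sub>R u" for u
  have n_diff: "?n differentiable (at y)" by (rule differentiable_grad[OF y dd\<phi>[OF y]])
  have a_lin: "a (v + w) = a v + a w" "a (v - w) = a v - a w" "a (c *\<^sub>R v) = c * a v" for v w c
    using linear_frechet_derivative[OF d\<phi>[OF y]] by (simp_all add: a_def linear_add linear_diff linear_scale)
  have \<Gamma>_lin: "?\<Gamma> u (v + w) = ?\<Gamma> u v + ?\<Gamma> u w" "?\<Gamma> u (v - w) = ?\<Gamma> u v - ?\<Gamma> u w" "?\<Gamma> u (c *\<^sub>R v) = c *\<^sub>R ?\<Gamma> u v" for u v w c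
    using bilinear_christoffel[OF y] by (simp_all add: bilinear_radd bilinear_rsub bilinear_rmul)
  have \<Gamma>_linl: "?\<Gamma> (v + w) u = ?\<Gamma> v u + ?\<Gamma> w u" "?\<Gamma> (c *\<^sub>R v) u = c *\<^sub>R ?\<Gamma> v u" for u v w c
    using bilinear_christoffel[OF y] by (simp_all add: bilinear_ladd bilinear_lmul)
  have ipN: "ip (G y) N l = a l" for l unfolding N_def a_def by (rule ip_grad[OF y d\<phi>[OF y]])
  have ipN': "ip (G y) l N = a l" for l using ipN spd_ip_commute[OF spd_G[OF y]] by metis
  have aN: "a N = k + k" unfolding k_def ipN by simp
  have h_sym: "h u v = h v u" for u v
    unfolding h_def by (rule second_derivative_symmetric[OF open_E y \<phi>])
  \<comment> \<open>Differentiating \<open>ip (G z) (grad \<phi> z) v = dd \<phi> z v\<close> and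
    using metric compatibility turns the covariant derivative of the gradient into the Hessian,
    whose symmetry makes \<open>S\<close> self-adjoint.\<close>
  have ipS: "ip (G y) (S u) v = h u v - a (?\<Gamma> u v) - a u * a v + k * ip (G y) u v" for u v
  proof -
    have "((\<lambda>z. ip (G z) (?n z) v) has_derivative
       (\<lambda>u. dd (\<lambda>z. ip (G z) N v) y u + ip (G y) (dd ?n y u) v + ip (G y) N (dd (\<lambda>z. v) y u))) (at y)"
      unfolding N_def
      by (rule has_derivative_bilinear_apply[OF open_E y bilinear_ip _ n_diff])
         (auto intro!: differentiable_bounded_linear[OF bounded_linear_ip_matrix] G_diff y)
    then have "dd (\<lambda>z. ip (G z) (?n z) v) y u = ip (dd G y u) N v + ip (G y) (dd ?n y u) v"
      by (simp add: dd_eqI dd_ip[OF y] ip_linear_simps)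
    moreover have "dd (\<lambda>z. ip (G z) (?n z) v) y = dd (\<lambda>z. dd \<phi> z v) y"
      by (rule dd_cong_open[OF open_E y]) (auto simp: ip_grad d\<phi> intro!: dd\<phi> y)
    ultimately have "h u v = ip (G y) (?\<Gamma> u N) v + a (?\<Gamma> u v) + ip (G y) (dd ?n y u) v"
      using christoffel_metric[OF y, of u N v] by (simp add: h_def ipN)
    then show ?thesis unfolding S_def by (simp add: ip_linear_simps ipN)
  qed
  have symS: "ip (G y) (S v) w = ip (G y) (S w) v" for v w
    unfolding ipS using h_sym[of v w] christoffel_commute[OF y, of v w] spd_ip_commute[OF spd_G[OF y], of v w] by simp
  have linS: "linear S" unfolding S_def
    by (rule linearI)
       (simp_all add: a_lin \<Gamma>_linl linear_add[OF linear_frechet_derivative[OF n_diff]]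
         linear_scale[OF linear_frechet_derivative[OF n_diff]] algebra_simps)
  let ?C = "\<lambda>v w. ?\<Gamma> v w + a v *\<^sub>R w + a w *\<^sub>R v - ip (G y) v w *\<^sub>R N"
  have chr: "christoffel (\<lambda>z. exp (2 * \<phi> z) *\<^sub>R G z) y v w = ?C v w" for v w
    unfolding a_def N_def by (rule christoffel_conformal[OF y d\<phi>[OF y]])
  \<comment> \<open>The formula of \<open>christoffel_conformal\<close> is differentiated as an
    identity on \<open>E\<close>; the values \<open>chr\<close> at the point \<open>y\<close> alone
    would not determine this derivative.\<close>
  have dchr: "dd (\<lambda>z. christoffel (\<lambda>z. exp (2 * \<phi> z) *\<^sub>R G z) z v w) y u =
     dd (\<lambda>z. christoffel G z v w) y u + h u v *\<^sub>R w + h u w *\<^sub>R v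
       - (ip (G y) (?\<Gamma> u v) w + ip (G y) v (?\<Gamma> u w)) *\<^sub>R N - ip (G y) v w *\<^sub>R dd ?n y u" for u v w
  proof -
    have "((\<lambda>z. christoffel G z v w + dd \<phi> z v *\<^sub>R w + dd \<phi> z w *\<^sub>R v - ip (G z) v w *\<^sub>R ?n z) has_derivative
       (\<lambda>u. dd (\<lambda>z. christoffel G z v w) y u + h u v *\<^sub>R w + h u w *\<^sub>R v
         - (ip (G y) v w *\<^sub>R dd ?n y u + dd (\<lambda>z. ip (G z) v w) y u *\<^sub>R ?n y))) (at y)"
      unfolding h_def
      by (intro has_derivative_diff has_derivative_add has_derivative_scaleR has_derivative_scaleR_left dd_works
          differentiable_christoffel y dd\<phi> n_diff differentiable_bounded_linear[OF bounded_linear_ip_matrix] G_diff)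
    note der = this
    have eq: "dd (\<lambda>z. christoffel (\<lambda>z. exp (2 * \<phi> z) *\<^sub>R G z) z v w) y =
        dd (\<lambda>z. christoffel G z v w + dd \<phi> z v *\<^sub>R w + dd \<phi> z w *\<^sub>R v - ip (G z) v w *\<^sub>R ?n z) y"
      by (rule dd_cong_open[OF open_E y christoffel_conformal[OF _ d\<phi>] has_derivative_differentiable[OF der]])
    show ?thesis unfolding eq dd_eqI[OF der]
      by (simp add: dd_ip[OF y] christoffel_metric[OF y, symmetric] N_def[symmetric] algebra_simps)
  qed
  have "curvature G y u v w = ip (G y) (S v) w *\<^sub>R u - ip (G y) (S u) w *\<^sub>R v + ip (G y) v w *\<^sub>R S u - ip (G y) u w *\<^sub>R S v" for u v w
  proof -
    have "curvature G y u v w - (ip (G y) (S v) w *\<^sub>R u - ip (G y) (S u) w *\<^sub>R v + ip (G y) v w *\<^sub>R S u - ip (G y) u w *\<^sub>R S v)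
      = curvature (\<lambda>z. exp (2 * \<phi> z) *\<^sub>R G z) y u v w"
      unfolding ipS unfolding S_def curvature_def chr dchr
      using h_sym[of u v] christoffel_commute[OF y, of u v] spd_ip_commute[OF spd_G[OF y], of w v]
        spd_ip_commute[OF spd_G[OF y], of w u] spd_ip_commute[OF spd_G[OF y], of u v]
      by (simp add: \<Gamma>_lin a_lin ip_linear_simps ipN' aN algebra_simps) (simp add: vec_eq_iff algebra_simps)
    then show ?thesis using flat[of u v w] by simp
  qed
  then show ?thesis unfolding schouten_form_def using linS symS by blast
qed

end

section \<open>The equations of Gauss and Ricci\<close>

context map_into_metric
begin

lemma differentiable_cov_dF:
  assumes "y \<in> D" shows "(cov_along G F v (\<lambda>z. dd F z w)) differentiable (at y)"
  by (rule has_derivative_differentiable[OF has_derivative_cov_along[OF assms dF_diff[OF assms]]])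
     (rule smooth_on_differentiable[OF smooth_on_dd[OF smooth_on_dd[OF smooth_F]] assms])

lemma ip_induced_metric:
  assumes y: "y \<in> D"
  shows "ip (induced_metric G F y) v w = ip (G (F y)) (dd F y v) (dd F y w)"
proof -
  have l: "linear (\<lambda>v. ip (G (F y)) (dd F y v) w)" "linear (\<lambda>v. ip (G (F y)) w (dd F y v))" for w
    using linear_dF[OF y] by (auto intro!: linearI simp: linear_add linear_scale ip_linear_simps)
  have "ip (G (F y)) (dd F y v) (dd F y w) = (\<Sum>i\<in>UNIV. v $ i *\<^sub>R ip (G (F y)) (dd F y (axis i 1)) (dd F y w))"
    by (rule linear_eq_sum_axis[OF l(1)])
  also have "\<dots> = (\<Sum>i\<in>UNIV. v $ i * (\<Sum>j\<in>UNIV. w $ j * ip (G (F y)) (dd F y (axis i 1)) (dd F y (axis j 1))))"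
    by (subst linear_eq_sum_axis[OF l(2), of _ w]) simp
  also have "\<dots> = ip (induced_metric G F y) v w"
    by (simp add: ip_def induced_metric_def inner_vec_def matrix_vector_mult_def mult.commute)
  finally show ?thesis ..
qed

lemma induced_metric_nth:
  "induced_metric G F y $ i $ j = ip (G (F y)) (dd F y (axis i 1)) (dd F y (axis j 1))"
  by (simp add: induced_metric_def)

lemma differentiable_induced_metric:
  assumes y: "y \<in> D" shows "induced_metric G F differentiable (at y)"
proof (intro differentiable_vec)
  show "(\<lambda>z. induced_metric G F z $ i $ j) differentiable (at y)" for i j
    unfolding induced_metric_nth
    by (rule has_derivative_differentiable[OF has_derivative_ip_along[OF y dF_diff[OF y] dF_diff[OF y]]])
qed

lemma ip_dd_induced_metric:
  assumes y: "y \<in> D"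
  shows "ip (dd (induced_metric G F) y u) v w =
    ip (G (F y)) (cov_along G F u (\<lambda>z. dd F z v) y) (dd F y w) + ip (G (F y)) (dd F y v) (cov_along G F u (\<lambda>z. dd F z w) y)"
proof -
  have "ip (dd (induced_metric G F) y u) v w = dd (\<lambda>z. ip (induced_metric G F z) v w) y u"
    using dd_bounded_linear[OF bounded_linear_ip_matrix differentiable_induced_metric[OF y]] by simp
  also have "dd (\<lambda>z. ip (induced_metric G F z) v w) y = dd (\<lambda>z. ip (G (F z)) (dd F z v) (dd F z w)) y"
    by (rule dd_cong_open[OF open_D y ip_induced_metric
        has_derivative_differentiable[OF has_derivative_ip_along[OF y dF_diff[OF y] dF_diff[OF y]]]])
  finally show ?thesis by (simp add: dd_ip_fields[OF y dF_diff[OF y] dF_diff[OF y]])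
qed

end

section \<open>Tangential and normal components along an immersion\<close>

locale immersed = map_into_metric E G D F
  for E :: "(real^'m) set" and G :: "'m metric" and D :: "(real^'n) set" and F :: "real^'n \<Rightarrow> real^'m" +
  assumes inj_dF: "\<And>z. z \<in> D \<Longrightarrow> inj (dd F z)"
begin

abbreviation g :: "'n metric" where "g \<equiv> induced_metric G F"

lemma spd_induced:
  assumes y: "y \<in> D" shows "spd (g y)"
proof -
  have "dd F y v \<noteq> 0" if "v \<noteq> 0" for v
    using inj_dF[OF y] linear_dF[OF y] that by (metis linear_injective_0)
  then show ?thesis
    using spd_G[OF F_into[OF y]] spd_ip_commute[OF spd_G[OF F_into[OF y]]]
    by (auto simp: spd_def ip_induced_metric[OF y] vec_eq_iff transpose_def induced_metric_nth)
qed

text \<open>Makes every lemma on \<open>G\<close> available for the connection of the induced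
  metric. The second differentiability comes from the formula for \<open>dd g\<close>, whose entries
  are inner products of differentiable fields along \<open>F\<close>.\<close>

sublocale induced: metric_domain D g
proof
  fix z v assume z: "z \<in> D"
  let ?k = "\<lambda>z i j. ip (G (F z)) (cov_along G F v (\<lambda>z. dd F z (axis i 1)) z) (dd F z (axis j 1))
       + ip (G (F z)) (dd F z (axis i 1)) (cov_along G F v (\<lambda>z. dd F z (axis j 1)) z)"
  have comp: "ip A (axis i 1) (axis j 1) = A $ i $ j" for A :: "real^'n^'n" and i j
    by (simp add: ip_def inner_axis' matrix_vector_mult_basis column_def)
  show "(\<lambda>z. dd g z v) differentiable (at z)"
  proof (rule differentiable_cong_open[OF open_D z])
    show "dd g y v = (\<chi> i j. ?k y i j)" if "y \<in> D" for y
      using ip_dd_induced_metric[OF that, of v "axis _ 1" "axis _ 1"] by (simp add: vec_eq_iff comp)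
    show "(\<lambda>y. \<chi> i j. ?k y i j) differentiable (at z)"
    proof (intro differentiable_vec, simp)
      show "(\<lambda>z. ?k z i j) differentiable (at z)" for i j
        by (intro differentiable_add has_derivative_differentiable[OF has_derivative_ip_along[OF z]]
            dF_diff differentiable_cov_dF z)
    qed
  qed
qed (use open_D spd_induced differentiable_induced_metric in auto)

text \<open>The adjoint of \<open>dd F y\<close> for the two metrics, which gives the coordinates of
  the tangential part of \<open>w\<close>.\<close>

definition tangent_coord :: "real^'n \<Rightarrow> real^'m \<Rightarrow> real^'n" where
  "tangent_coord y w = matrix_inv (g y) *v (\<chi> i. ip (G (F y)) w (dd F y (axis i 1)))"

lemma ip_tangent_coord:
  assumes y: "y \<in> D" shows "ip (g y) (tangent_coord y w) v = ip (G (F y)) w (dd F y v)"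
proof -
  have "linear (\<lambda>v. ip (G (F y)) w (dd F y v))"
    using linear_dF[OF y] by (auto intro!: linearI simp: linear_add linear_scale ip_linear_simps)
  from linear_eq_sum_axis[OF this, of v] show ?thesis
    unfolding tangent_coord_def ip_matrix_inv[OF spd_induced[OF y]]
    by (simp add: inner_vec_def mult.commute)
qed

lemma normal_part_eq:
  assumes y: "y \<in> D" shows "normal_part G F y w = w - dd F y (tangent_coord y w)"
proof -
  let ?b = "\<lambda>i. ip (G (F y)) w (dd F y (axis i 1))"
  have "dd F y (tangent_coord y w) = (\<Sum>j\<in>UNIV. (\<Sum>i\<in>UNIV. matrix_inv (g y) $ j $ i * ?b i) *\<^sub>R dd F y (axis j 1))"
    by (subst linear_eq_sum_axis[OF linear_dF[OF y]]) (simp add: tangent_coord_def matrix_vector_mult_def)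
  also have "\<dots> = (\<Sum>j\<in>UNIV. \<Sum>i\<in>UNIV. matrix_inv (g y) $ i $ j *\<^sub>R ?b i *\<^sub>R dd F y (axis j 1))"
    using spd_matrix_inv_symmetric[OF spd_induced[OF y]]
    by (intro sum.cong refl) (simp add: scaleR_sum_left)
  also have "\<dots> = (\<Sum>i\<in>UNIV. \<Sum>j\<in>UNIV. matrix_inv (g y) $ i $ j *\<^sub>R ?b i *\<^sub>R dd F y (axis j 1))"
    by (rule sum.swap)
  finally show ?thesis unfolding normal_part_def metric_trace_def by simp
qed

lemma normal_part_normal:
  assumes y: "y \<in> D"
  shows "ip (G (F y)) (normal_part G F y w) (dd F y v) = 0" "ip (G (F y)) (dd F y v) (normal_part G F y w) = 0"
proof -
  show "ip (G (F y)) (normal_part G F y w) (dd F y v) = 0"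
    by (simp add: normal_part_eq[OF y] ip_linear_simps ip_induced_metric[OF y, symmetric] ip_tangent_coord[OF y])
  then show "ip (G (F y)) (dd F y v) (normal_part G F y w) = 0"
    using spd_ip_commute[OF spd_G[OF F_into[OF y]]] by metis
qed

text \<open>The tangential part of the ambient connection satisfies the Koszul formula of
  \<open>g\<close>: the three derivatives of the metric give six terms, four of which cancel because
  the torsion vanishes.\<close>

lemma tangent_coord_cov_dF:
  assumes y: "y \<in> D"
  shows "tangent_coord y (cov_along G F v (\<lambda>z. dd F z w) y) = christoffel g y v w"
proof (rule spd_eqI[OF spd_induced[OF y]])
  fix l
  have c: "ip (G (F y)) (dd F y b) (cov_along G F u (\<lambda>z. dd F z a) y) = ip (G (F y)) (cov_along G F u (\<lambda>z. dd F z a) y) (dd F y b)" for u a b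
    by (rule spd_ip_commute[OF spd_G[OF F_into[OF y]]])
  show "ip (g y) (tangent_coord y (cov_along G F v (\<lambda>z. dd F z w) y)) l = ip (g y) (christoffel g y v w) l"
    unfolding ip_tangent_coord[OF y] induced.koszul[OF y] ip_dd_induced_metric[OF y] c
    using cov_along_dF_commute[OF y, of v w] cov_along_dF_commute[OF y, of v l] cov_along_dF_commute[OF y, of w l]
    by simp
qed

abbreviation h where "h \<equiv> second_fundamental_form G F"

lemma gauss_formula:
  assumes y: "y \<in> D"
  shows "cov_along G F v (\<lambda>z. dd F z w) y = dd F y (christoffel g y v w) + h y v w"
  by (simp add: second_fundamental_form_def normal_part_eq[OF y] tangent_coord_cov_dF[OF y])

lemma second_fundamental_form_normal:
  assumes y: "y \<in> D"
  shows "ip (G (F y)) (h y v w) (dd F y l) = 0" "ip (G (F y)) (dd F y l) (h y v w) = 0"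
  unfolding second_fundamental_form_def by (rule normal_part_normal[OF y])+

lemma second_fundamental_form_commute:
  assumes y: "y \<in> D" shows "h y v w = h y w v"
  unfolding second_fundamental_form_def cov_along_dF_commute[OF y, of v w] ..

lemma bilinear_second_fundamental_form:
  assumes y: "y \<in> D" shows "bilinear (h y)"
proof -
  have eq: "h y v w = cov_along G F v (\<lambda>z. dd F z w) y - dd F y (christoffel g y v w)" for v w
    by (simp add: gauss_formula[OF y])
  have 1: "linear (\<lambda>v. h y v w)" for w
    unfolding eq cov_along_def
    by (rule linearI)
       (simp_all add: linear_add[OF linear_frechet_derivative[OF dF_diff[OF y]]] linear_scale[OF linear_frechet_derivative[OF dF_diff[OF y]]]
         linear_add[OF linear_dF[OF y]] linear_scale[OF linear_dF[OF y]]
         bilinear_ladd[OF bilinear_christoffel[OF F_into[OF y]]] bilinear_lmul[OF bilinear_christoffel[OF F_into[OF y]]]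
         bilinear_ladd[OF induced.bilinear_christoffel[OF y]] bilinear_lmul[OF induced.bilinear_christoffel[OF y]] algebra_simps)
  then show ?thesis unfolding bilinear_def
    using second_fundamental_form_commute[OF y] by (metis (no_types, lifting) ext)
qed

text \<open>One half of the Gauss equation. The inner product of \<open>?W\<close> with a tangent
  field sees only the tangential part of \<open>?W\<close>, so its derivative can be computed in
  \<open>g\<close>; shifting the outer derivative to the tangent field yields the product of second
  fundamental forms.\<close>

lemma ip_cov_cov_dF:
  assumes y: "y \<in> D"
  shows "ip (G (F y)) (cov_along G F u (cov_along G F v (\<lambda>z. dd F z w)) y) (dd F y x) =
    ip (g y) (dd (\<lambda>z. christoffel g z v w) y u + christoffel g y u (christoffel g y v w)) x
      - ip (G (F y)) (h y v w) (h y u x)"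
proof -
  let ?W = "cov_along G F v (\<lambda>z. dd F z w)" and ?X = "\<lambda>z. christoffel g z v w"
  have "ip (G (F y)) (cov_along G F u ?W y) (dd F y x) = dd (\<lambda>z. ip (G (F z)) (?W z) (dd F z x)) y u
      - ip (G (F y)) (?W y) (cov_along G F u (\<lambda>z. dd F z x) y)"
    using dd_ip_fields[OF y differentiable_cov_dF[OF y] dF_diff[OF y]] by simp
  also have "ip (G (F y)) (?W y) (cov_along G F u (\<lambda>z. dd F z x) y) =
     ip (g y) (?X y) (christoffel g y u x) + ip (G (F y)) (h y v w) (h y u x)"
    by (simp add: gauss_formula[OF y] ip_linear_simps second_fundamental_form_normal[OF y] ip_induced_metric[OF y])
  also have "dd (\<lambda>z. ip (G (F z)) (?W z) (dd F z x)) y u = ip (dd g y u) (?X y) x + ip (g y) (dd ?X y u) x"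
  proof -
    have der: "((\<lambda>z. ip (g z) (?X z) x) has_derivative
       (\<lambda>u. dd (\<lambda>z. ip (g z) (?X y) x) y u + ip (g y) (dd ?X y u) x + ip (g y) (?X y) (dd (\<lambda>z. x) y u))) (at y)"
      by (rule has_derivative_bilinear_apply[OF open_D y bilinear_ip])
         (auto intro!: induced.differentiable_christoffel y differentiable_bounded_linear[OF bounded_linear_ip_matrix] induced.G_diff)
    have same: "ip (G (F z)) (?W z) (dd F z x) = ip (g z) (?X z) x" if "z \<in> D" for z
      by (simp add: gauss_formula[OF that] ip_linear_simps second_fundamental_form_normal[OF that] ip_induced_metric[OF that])
    have "dd (\<lambda>z. ip (G (F z)) (?W z) (dd F z x)) y = dd (\<lambda>z. ip (g z) (?X z) x) y"
      by (rule dd_cong_open[OF open_D y same has_derivative_differentiable[OF der]])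
    then show ?thesis by (simp add: dd_eqI[OF der] induced.dd_ip[OF y] ip_linear_simps)
  qed
  finally show ?thesis
    using induced.christoffel_metric[OF y, of u "?X y" x] by (simp add: ip_linear_simps)
qed

theorem gauss_equation:
  assumes y: "y \<in> D"
  shows "ip (g y) (curvature g y u v w) x = ip (G (F y)) (curvature G (F y) (dd F y u) (dd F y v) (dd F y w)) (dd F y x)
    + ip (G (F y)) (h y v w) (h y u x) - ip (G (F y)) (h y u w) (h y v x)"
  unfolding cov_along_curvature[OF open_D y order_refl smooth_on_dd[OF smooth_F], symmetric]
  unfolding ip_linear_simps ip_cov_cov_dF[OF y] curvature_def by simp

text \<open>The fields \<open>?W\<close> and \<open>?N\<close> differ by a tangent field, so they
  have the same inner product with the normal field \<open>\<eta>\<close>. Differentiating both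
  inner products compares the two connections, and the discrepancy is the tangential part of
  \<open>?W\<close> paired with the derivative of \<open>\<eta>\<close>.\<close>

lemma ricci_equation_aux:
  assumes U: "open U" "y \<in> U" "U \<subseteq> D" and \<xi>: "smooth_on U \<xi>" and \<eta>: "smooth_on U \<eta>"
    and \<eta>_normal: "\<And>z v. z \<in> U \<Longrightarrow> ip (G (F z)) (\<eta> z) (dd F z v) = 0"
  shows "ip (G (F y)) (cov_along G F u (cov_along G F v \<xi>) y) (\<eta> y) =
    ip (G (F y)) (normal_connection G F u (normal_connection G F v \<xi>) y) (\<eta> y)
     - ip (g y) (tangent_coord y (cov_along G F v \<xi> y)) (tangent_coord y (cov_along G F u \<eta> y))"
proof -
  have y: "y \<in> D" using U by auto
  let ?W = "cov_along G F v \<xi>" and ?N = "normal_connection G F v \<xi>"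
  have \<eta>': "ip (G (F z)) (dd F z v) (\<eta> z) = 0" if "z \<in> U" for z v
    using \<eta>_normal[OF that] spd_ip_commute[OF spd_G[OF F_into]] that U(3) by (metis subsetD)
  have W: "?W differentiable (at z)" if "z \<in> U" for z
    using U(3) that by (intro has_derivative_differentiable[OF has_derivative_cov_along]
      smooth_on_differentiable[OF \<xi>] smooth_on_differentiable[OF smooth_on_dd[OF \<xi>]]) auto
  have N_eq: "?N z = ?W z - dd F z (tangent_coord z (?W z))" if "z \<in> D" for z
    unfolding normal_connection_def normal_part_eq[OF that] ..
  have T: "(\<lambda>z. tangent_coord z (?W z)) differentiable (at y)"
    unfolding tangent_coord_def
  proof (intro differentiable_matrix_inv_mult[OF open_D y] spd_invertible spd_induced induced.G_diff y differentiable_vec)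
    show "(\<lambda>z. (\<chi> i. ip (G (F z)) (?W z) (dd F z (axis i 1))) $ i) differentiable (at y)" for i
      using has_derivative_differentiable[OF has_derivative_ip_along[OF y W[OF U(2)] dF_diff[OF y]]] by simp
  qed
  have N: "?N differentiable (at y)"
  proof (rule differentiable_cong_open[OF open_D y])
    show "(\<lambda>z. ?W z - dd F z (tangent_coord z (?W z))) differentiable (at y)"
      by (intro differentiable_diff W U(2) has_derivative_differentiable[OF has_derivative_dF_apply[OF y T]])
  qed (rule N_eq)
  note d\<eta> = smooth_on_differentiable[OF \<eta> U(2)]
  have same: "ip (G (F z)) (?N z) (\<eta> z) = ip (G (F z)) (?W z) (\<eta> z)" if "z \<in> U" for z
    using N_eq[of z] \<eta>'[OF that] U(3) that by (auto simp: ip_linear_simps)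
  have "dd (\<lambda>z. ip (G (F z)) (?N z) (\<eta> z)) y = dd (\<lambda>z. ip (G (F z)) (?W z) (\<eta> z)) y"
    by (rule dd_cong_open[OF U(1,2) same has_derivative_differentiable[OF has_derivative_ip_along[OF y W[OF U(2)] d\<eta>]]])
  then have "ip (G (F y)) (cov_along G F u ?N y) (\<eta> y) + ip (G (F y)) (?N y) (cov_along G F u \<eta> y)
     = ip (G (F y)) (cov_along G F u ?W y) (\<eta> y) + ip (G (F y)) (?W y) (cov_along G F u \<eta> y)"
    by (simp add: dd_ip_fields[OF y N d\<eta>, symmetric] dd_ip_fields[OF y W[OF U(2)] d\<eta>, symmetric])
  moreover have "ip (G (F y)) (normal_connection G F u ?N y) (\<eta> y) = ip (G (F y)) (cov_along G F u ?N y) (\<eta> y)"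
    unfolding normal_connection_def[of G F u] normal_part_eq[OF y] by (simp add: ip_linear_simps \<eta>'[OF U(2)])
  moreover have "ip (G (F y)) (?W y) (cov_along G F u \<eta> y) - ip (G (F y)) (?N y) (cov_along G F u \<eta> y)
      = ip (g y) (tangent_coord y (?W y)) (tangent_coord y (cov_along G F u \<eta> y))"
    unfolding N_eq[OF y] spd_ip_commute[OF spd_induced[OF y], of "tangent_coord y (?W y)"]
    unfolding ip_tangent_coord[OF y]
    by (simp add: ip_linear_simps) (rule spd_ip_commute[OF spd_G[OF F_into[OF y]]])
  ultimately show ?thesis by simp
qed

text \<open>The Weingarten equation, from differentiating
  \<open>ip (G (F z)) (\<xi> z) (dd F z x) = 0\<close>.\<close>

lemma ip_tangent_coord_cov_normal:
  assumes U: "open U" "y \<in> U" "U \<subseteq> D" and \<xi>: "smooth_on U \<xi>"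
    and \<xi>_normal: "\<And>z v. z \<in> U \<Longrightarrow> ip (G (F z)) (\<xi> z) (dd F z v) = 0"
  shows "ip (g y) (tangent_coord y (cov_along G F v \<xi> y)) x = - ip (G (F y)) (\<xi> y) (h y v x)"
proof -
  have y: "y \<in> D" using U by auto
  have "dd (\<lambda>z. ip (G (F z)) (\<xi> z) (dd F z x)) y = dd (\<lambda>z. 0 :: real) y"
    by (rule dd_cong_open[OF U(1,2) \<xi>_normal]) auto
  then have "ip (G (F y)) (cov_along G F v \<xi> y) (dd F y x) + ip (G (F y)) (\<xi> y) (cov_along G F v (\<lambda>z. dd F z x) y) = 0"
    by (simp add: dd_ip_fields[OF y smooth_on_differentiable[OF \<xi> U(2)] dF_diff[OF y], symmetric])
  then show ?thesis
    by (simp add: ip_tangent_coord[OF y] gauss_formula[OF y] ip_linear_simps \<xi>_normal[OF U(2)])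
qed

text \<open>By the Weingarten equation the corrections in \<open>ricci_equation_aux\<close> are
  inner products of values of shape operators. Parseval in \<open>e\<close> writes them as sums, in
  which the two minus signs cancel.\<close>

theorem ricci_equation:
  assumes U: "open U" "y \<in> U" "U \<subseteq> D" and \<xi>: "smooth_on U \<xi>" and \<eta>: "smooth_on U \<eta>"
    and \<xi>_normal: "\<And>z v. z \<in> U \<Longrightarrow> ip (G (F z)) (\<xi> z) (dd F z v) = 0"
    and \<eta>_normal: "\<And>z v. z \<in> U \<Longrightarrow> ip (G (F z)) (\<eta> z) (dd F z v) = 0"
    and e: "orthonormal_family (g y) CARD('n) e"
  shows "normal_curvature G F y u v \<xi> \<eta> = ip (G (F y)) (curvature G (F y) (dd F y u) (dd F y v) (\<xi> y)) (\<eta> y)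
    + (\<Sum>k\<in>{1..CARD('n)}. ip (G (F y)) (\<xi> y) (h y v (e k)) * ip (G (F y)) (\<eta> y) (h y u (e k)))
    - (\<Sum>k\<in>{1..CARD('n)}. ip (G (F y)) (\<xi> y) (h y u (e k)) * ip (G (F y)) (\<eta> y) (h y v (e k)))"
proof -
  have y: "y \<in> D" using U by auto
  have t: "ip (g y) (tangent_coord y (cov_along G F a \<xi> y)) x = - ip (G (F y)) (\<xi> y) (h y a x)"
    "ip (g y) (tangent_coord y (cov_along G F a \<eta> y)) x = - ip (G (F y)) (\<eta> y) (h y a x)" for a x
    by (rule ip_tangent_coord_cov_normal[OF U \<xi> \<xi>_normal], assumption)
       (rule ip_tangent_coord_cov_normal[OF U \<eta> \<eta>_normal])
  have "ip (g y) (tangent_coord y (cov_along G F a \<xi> y)) (tangent_coord y (cov_along G F b \<eta> y))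
     = (\<Sum>k\<in>{1..CARD('n)}. ip (G (F y)) (\<xi> y) (h y a (e k)) * ip (G (F y)) (\<eta> y) (h y b (e k)))" for a b
    unfolding orthonormal_family_parseval[OF e spd_induced[OF y], of "tangent_coord y (cov_along G F a \<xi> y)" "tangent_coord y (cov_along G F b \<eta> y)"]
    unfolding t by simp
  then show ?thesis
    unfolding cov_along_curvature[OF U \<xi>, symmetric] normal_curvature_def
    by (simp add: ip_linear_simps ricci_equation_aux[OF U \<xi> \<eta> \<eta>_normal])
qed

end

section \<open>Minimal submanifolds of conformally flat spaces\<close>

lemma sum_upper_triangle:
  fixes f :: "nat \<Rightarrow> nat \<Rightarrow> real"
  assumes sym: "\<And>i j. i \<in> {1..n} \<Longrightarrow> j \<in> {1..n} \<Longrightarrow> f i j = f j i"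
  shows "2 * (\<Sum>i\<in>{1..n}. \<Sum>j\<in>{i<..n}. f i j) = (\<Sum>i\<in>{1..n}. \<Sum>j\<in>{1..n}. f i j) - (\<Sum>i\<in>{1..n}. f i i)"
proof -
  let ?I = "{1..n}"
  have up: "(\<Sum>j\<in>{i<..n}. f i j) = (\<Sum>j\<in>?I. if i < j then f i j else 0)" if "i \<in> ?I" for i
    using that by (intro sum.mono_neutral_cong_left) auto
  have "(\<Sum>i\<in>?I. \<Sum>j\<in>?I. f i j) = (\<Sum>i\<in>?I. \<Sum>j\<in>?I. (if i < j then f i j else 0) + (if j < i then f j i else 0) + (if j = i then f i i else 0))"
    by (intro sum.cong refl) (auto simp: sym)
  also have "\<dots> = (\<Sum>i\<in>?I. \<Sum>j\<in>?I. if i < j then f i j else 0) + (\<Sum>i\<in>?I. \<Sum>j\<in>?I. if j < i then f j i else 0) + (\<Sum>i\<in>?I. f i i)"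
    by (simp add: sum.distrib)
  also have "(\<Sum>i\<in>?I. \<Sum>j\<in>?I. if j < i then f j i else 0) = (\<Sum>i\<in>?I. \<Sum>j\<in>?I. if i < j then f i j else 0)"
    by (rule sum.swap)
  finally show ?thesis using up by simp
qed

lemma sum_swap_pairs:
  "(\<Sum>i\<in>I. \<Sum>j\<in>J. \<Sum>r\<in>R. \<Sum>s\<in>S. f i j r s) = (\<Sum>r\<in>R. \<Sum>s\<in>S. \<Sum>i\<in>I. \<Sum>j\<in>J. f i j r s)"
proof -
  have "(\<Sum>i\<in>I. \<Sum>j\<in>J. \<Sum>r\<in>R. \<Sum>s\<in>S. f i j r s) = (\<Sum>i\<in>I. \<Sum>r\<in>R. \<Sum>j\<in>J. \<Sum>s\<in>S. f i j r s)"
    by (rule sum.cong[OF refl], rule sum.swap)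
  also have "\<dots> = (\<Sum>r\<in>R. \<Sum>i\<in>I. \<Sum>j\<in>J. \<Sum>s\<in>S. f i j r s)" by (rule sum.swap)
  also have "\<dots> = (\<Sum>r\<in>R. \<Sum>i\<in>I. \<Sum>s\<in>S. \<Sum>j\<in>J. f i j r s)"
    by (rule sum.cong[OF refl], rule sum.cong[OF refl], rule sum.swap)
  also have "\<dots> = (\<Sum>r\<in>R. \<Sum>s\<in>S. \<Sum>i\<in>I. \<Sum>j\<in>J. f i j r s)"
    by (rule sum.cong[OF refl], rule sum.swap)
  finally show ?thesis .
qed

lemma norm_square_matrix: "(norm (X :: real^'n^'m))\<^sup>2 = (\<Sum>i\<in>UNIV. \<Sum>j\<in>UNIV. (X $ i $ j)\<^sup>2)"
  unfolding power2_norm_eq_inner inner_vec_def by (simp add: power2_eq_square)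

text \<open>Frames are indexed by numbers, matrices by the type \<open>'n\<close>; the bijection
  \<open>b\<close> carries the inequality over.\<close>

lemma ddvv_inequality_nat:
  fixes a :: "'r \<Rightarrow> nat \<Rightarrow> nat \<Rightarrow> real"
  assumes J: "finite J" and sym: "\<And>r i j. r \<in> J \<Longrightarrow> i \<in> {1..CARD('n::finite)} \<Longrightarrow> j \<in> {1..CARD('n)} \<Longrightarrow> a r i j = a r j i"
  shows "(\<Sum>r\<in>J. \<Sum>s\<in>J. \<Sum>i\<in>{1..CARD('n)}. \<Sum>j\<in>{1..CARD('n)}.
      ((\<Sum>k\<in>{1..CARD('n)}. a r i k * a s k j) - (\<Sum>k\<in>{1..CARD('n)}. a s i k * a r k j))\<^sup>2)
    \<le> (\<Sum>r\<in>J. \<Sum>i\<in>{1..CARD('n)}. \<Sum>j\<in>{1..CARD('n)}. (a r i j)\<^sup>2)\<^sup>2"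
proof -
  let ?I = "{1..CARD('n)}"
  obtain b :: "'n \<Rightarrow> nat" where b: "bij_betw b UNIV ?I"
    using finite_same_card_bij[of "UNIV :: 'n set" ?I] by auto
  have re: "(\<Sum>i\<in>UNIV. q (b i)) = (\<Sum>i\<in>?I. q i)" for q :: "nat \<Rightarrow> real"
    by (rule sum.reindex_bij_betw[OF b])
  have bI: "b i \<in> ?I" for i using b by (auto simp: bij_betw_def)
  define A :: "'r \<Rightarrow> real^'n^'n" where "A r = (\<chi> i j. a r (b i) (b j))" for r
  have "transpose (A r) = A r" if "r \<in> J" for r
    using sym[OF that bI bI] by (simp add: A_def transpose_def vec_eq_iff)
  from ddvv_inequality[OF J this]
  have "(\<Sum>r\<in>J. \<Sum>s\<in>J. (norm (commutator (A r) (A s)))\<^sup>2) \<le> (\<Sum>r\<in>J. (norm (A r))\<^sup>2)\<^sup>2" .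
  moreover have "(norm (A r))\<^sup>2 = (\<Sum>i\<in>?I. \<Sum>j\<in>?I. (a r i j)\<^sup>2)" for r
    by (simp only: norm_square_matrix A_def vec_lambda_beta re[of "\<lambda>j. (a r _ j)\<^sup>2"] re[of "\<lambda>i. \<Sum>j\<in>?I. (a r i j)\<^sup>2"])
  moreover have "(norm (commutator (A r) (A s)))\<^sup>2 = (\<Sum>i\<in>?I. \<Sum>j\<in>?I.
      ((\<Sum>k\<in>?I. a r i k * a s k j) - (\<Sum>k\<in>?I. a s i k * a r k j))\<^sup>2)" for r s
    unfolding norm_square_matrix commutator_def
    by (simp only: A_def matrix_matrix_mult_def vector_minus_component vec_lambda_beta re[of "\<lambda>k. a r _ k * a s k _"] re[of "\<lambda>k. a s _ k * a r k _"]
        re[of "\<lambda>j. ((\<Sum>k\<in>?I. a r _ k * a s k j) - (\<Sum>k\<in>?I. a s _ k * a r k j))\<^sup>2"]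
        re[of "\<lambda>i. \<Sum>j\<in>?I. ((\<Sum>k\<in>?I. a r i k * a s k j) - (\<Sum>k\<in>?I. a s i k * a r k j))\<^sup>2"])
  ultimately show ?thesis by simp
qed

context immersed
begin

lemma card_le: "y \<in> D \<Longrightarrow> CARD('n) \<le> CARD('m)"
proof -
  assume y: "y \<in> D"
  have "dim (range (dd F y)) = dim (UNIV :: (real^'n) set)"
    by (rule dim_image_eq[OF linear_dF[OF y]]) (use inj_dF[OF y] in \<open>simp add: inj_on_def inj_def\<close>)
  then show ?thesis using dim_subset_UNIV[of "range (dd F y)"] by (simp add: dim_UNIV)
qed

text \<open>The images of the tangent frame and the normal vectors together form an orthonormal
  family of full length \<open>CARD('m)\<close>, and the tangential coefficients of \<open>w\<close>
  vanish.\<close>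

lemma ip_normal_parseval:
  assumes y: "y \<in> D" and e: "orthonormal_family (g y) CARD('n) e"
    and \<nu>: "orthonormal_family (G (F y)) (CARD('m) - CARD('n)) \<nu>"
    and normal: "\<And>r v. r \<in> {1..CARD('m) - CARD('n)} \<Longrightarrow> ip (G (F y)) (\<nu> r) (dd F y v) = 0"
    and w: "\<And>v. ip (G (F y)) w (dd F y v) = 0"
  shows "ip (G (F y)) w w' = (\<Sum>r\<in>{1..CARD('m) - CARD('n)}. ip (G (F y)) (\<nu> r) w * ip (G (F y)) (\<nu> r) w')"
proof -
  let ?n = "CARD('n)" and ?m = "CARD('m)" and ?A = "G (F y)"
  have spd: "spd ?A" by (rule spd_G[OF F_into[OF y]])
  have nm: "?n \<le> ?m" by (rule card_le[OF y])
  define \<epsilon> where "\<epsilon> k = (if k \<le> ?n then dd F y (e k) else \<nu> (k - ?n))" for k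
  have normal': "ip ?A (dd F y v) (\<nu> r) = 0" if "r \<in> {1..?m - ?n}" for r v
    using normal[OF that] spd_ip_commute[OF spd] by metis
  have "orthonormal_family ?A ?m \<epsilon>"
    unfolding orthonormal_family_def
  proof (intro ballI)
    fix i j assume ij: "i \<in> {1..?m}" "j \<in> {1..?m}"
    have tang: "ip ?A (dd F y (e i)) (dd F y (e j)) = (if i = j then 1 else 0)" if "i \<le> ?n" "j \<le> ?n"
      using e ij that by (simp add: orthonormal_family_def ip_induced_metric[OF y, symmetric])
    have norm: "ip ?A (\<nu> (i - ?n)) (\<nu> (j - ?n)) = (if i = j then 1 else 0)" if "\<not> i \<le> ?n" "\<not> j \<le> ?n"
    proof -
      have "i - ?n \<in> {1..?m - ?n}" "j - ?n \<in> {1..?m - ?n}" using ij that by auto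
      then have "ip ?A (\<nu> (i - ?n)) (\<nu> (j - ?n)) = (if i - ?n = j - ?n then 1 else 0)"
        using \<nu> unfolding orthonormal_family_def by blast
      then show ?thesis using that by auto
    qed
    have "k - ?n \<in> {1..?m - ?n}" if "k \<in> {1..?m}" "\<not> k \<le> ?n" for k using that by auto
    then show "ip ?A (\<epsilon> i) (\<epsilon> j) = (if i = j then 1 else 0)"
      using ij tang norm normal normal' by (auto simp: \<epsilon>_def)
  qed
  from orthonormal_family_parseval[OF this spd, of w w']
  have "ip ?A w w' = (\<Sum>k\<in>{1..?m}. ip ?A w (\<epsilon> k) * ip ?A w' (\<epsilon> k))" .
  also have "\<dots> = (\<Sum>k\<in>{?n + 1..?n + (?m - ?n)}. ip ?A w (\<epsilon> k) * ip ?A w' (\<epsilon> k))"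
    using nm w by (intro sum.mono_neutral_right) (auto simp: \<epsilon>_def not_le)
  also have "\<dots> = (\<Sum>r\<in>{1..?m - ?n}. ip ?A w (\<epsilon> (r + ?n)) * ip ?A w' (\<epsilon> (r + ?n)))"
    using sum.shift_bounds_cl_nat_ivl[of "\<lambda>k. ip ?A w (\<epsilon> k) * ip ?A w' (\<epsilon> k)" 1 ?n "?m - ?n"]
    by (simp add: add.commute)
  also have "\<dots> = (\<Sum>r\<in>{1..?m - ?n}. ip ?A (\<nu> r) w * ip ?A (\<nu> r) w')"
    by (intro sum.cong refl) (auto simp: \<epsilon>_def spd_ip_commute[OF spd, of w] spd_ip_commute[OF spd, of w'])
  finally show ?thesis .
qed

text \<open>With \<open>Q\<close> the sum of the \<open>q i\<close> and \<open>X\<close> the squared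
  norm of \<open>h\<close>, the right-hand side is exactly \<open>2 / N * Q\<close>, and the
  normalized scalar curvature falls short of it by \<open>X / (N * (N - 1))\<close>. The matrix
  inequality bounds the normal term by that same amount.\<close>

theorem minimal_scalar_curvature_bound:
  assumes y: "y \<in> D" and S: "schouten_form (G (F y)) S (curvature G (F y))"
    and n: "CARD('n) \<ge> 2" and m: "CARD('m) \<ge> 3"
    and e: "orthonormal_family (g y) CARD('n) e"
    and \<upsilon>: "\<And>r. r \<in> {1..CARD('m) - CARD('n)} \<Longrightarrow> smooth_on D (\<upsilon> r)"
    and \<upsilon>_on: "orthonormal_family (G (F y)) (CARD('m) - CARD('n)) (\<lambda>r. \<upsilon> r y)"
    and \<upsilon>_normal: "\<And>z r v. z \<in> D \<Longrightarrow> r \<in> {1..CARD('m) - CARD('n)} \<Longrightarrow> ip (G (F z)) (\<upsilon> r z) (dd F z v) = 0"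
    and minimal: "minimal_at G F y"
  shows "normalized_scalar_curvature g y e + normalized_normal_scalar_curvature G F y e \<upsilon>
    \<le> 2 / (real CARD('n) * (real CARD('m) - 2)) * (\<Sum>j\<in>{1..CARD('n)}. ricci G (F y) (dd F y (e j)) (dd F y (e j)))
          - 2 * half_scalar_curvature G (F y) / ((real CARD('m) - 1) * (real CARD('m) - 2))"
proof -
  let ?n = "CARD('n)" and ?m = "CARD('m)" and ?A = "G (F y)"
  let ?I = "{1..?n}" and ?J = "{1..?m - ?n}"
  let ?e = "\<lambda>i. dd F y (e i)"
  define N where "N = real ?n"
  define M where "M = real ?m"
  have NM: "N \<ge> 2" "M \<ge> 3" using n m by (simp_all add: N_def M_def)
  have spd: "spd ?A" by (rule spd_G[OF F_into[OF y]])
  have ee: "ip (g y) (e i) (e j) = (if i = j then 1 else 0)" if "i \<in> ?I" "j \<in> ?I" for i j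
    using e that unfolding orthonormal_family_def by blast
  have EE: "ip ?A (?e i) (?e j) = (if i = j then 1 else 0)" if "i \<in> ?I" "j \<in> ?I" for i j
    using ee[OF that] by (simp add: ip_induced_metric[OF y])
  have \<upsilon>_normal': "ip ?A (?e i) (\<upsilon> r y) = 0" if "r \<in> ?J" for r i
    using \<upsilon>_normal[OF y that] spd_ip_commute[OF spd] by metis
  have R: "curvature G (F y) u v w = ip ?A (S v) w *\<^sub>R u - ip ?A (S u) w *\<^sub>R v + ip ?A v w *\<^sub>R S u - ip ?A u w *\<^sub>R S v" for u v w
    using S by (simp add: schouten_form_def)
  define a where "a r i j = ip ?A (\<upsilon> r y) (h y (e i) (e j))" for r i j
  define q where "q i = ip ?A (S (?e i)) (?e i)" for i
  define Q where "Q = (\<Sum>i\<in>?I. q i)"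
  define X where "X = (\<Sum>r\<in>?J. \<Sum>i\<in>?I. \<Sum>j\<in>?I. (a r i j)\<^sup>2)"
  \<comment> \<open>The part of the Gauss equation that is quadratic in \<open>h\<close>. Summed
    over all pairs, its first product becomes the squared trace of each shape operator, which
    minimality makes zero.\<close>
  define T where "T i j = (\<Sum>r\<in>?J. a r i i * a r j j - (a r i j)\<^sup>2)" for i j
  have X0: "0 \<le> X" by (auto simp: X_def intro!: sum_nonneg)
  have a_sym: "a r i j = a r j i" for r i j
    unfolding a_def second_fundamental_form_commute[OF y, of "e i"] ..
  have trace0: "(\<Sum>i\<in>?I. a r i i) = 0" for r
  proof -
    have "metric_trace (g y) (h y) = 0" using minimal n by (auto simp: minimal_at_def mean_curvature_def)
    then have "(\<Sum>i\<in>?I. h y (e i) (e i)) = 0"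
      by (simp add: metric_trace_orthonormal[OF spd_induced[OF y] e bilinear_second_fundamental_form[OF y]])
    then show ?thesis unfolding a_def ip_sum_right[symmetric] by (simp add: ip_linear_simps)
  qed
  have hh: "ip ?A (h y (e i) (e j)) (h y (e k) (e l)) = (\<Sum>r\<in>?J. a r i j * a r k l)" for i j k l
    unfolding a_def
    by (rule ip_normal_parseval[OF y e \<upsilon>_on \<upsilon>_normal[OF y] second_fundamental_form_normal(1)[OF y]])
  have sec: "sectional_curvature g y (e i) (e j) = q i + q j + T i j" if ij: "i \<in> ?I" "j \<in> ?I" "i \<noteq> j" for i j
  proof -
    have "sectional_curvature g y (e i) (e j) = ip (g y) (curvature g y (e i) (e j) (e j)) (e i)"
      unfolding sectional_curvature_def using ij by (simp add: ee)
    also have "\<dots> = ip ?A (curvature G (F y) (?e i) (?e j) (?e j)) (?e i) + T i j"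
      unfolding gauss_equation[OF y] hh T_def
      by (simp add: sum_subtractf a_sym[of _ j i] power2_eq_square mult.commute)
    also have "ip ?A (curvature G (F y) (?e i) (?e j) (?e j)) (?e i) = q i + q j"
      unfolding R using ij by (simp add: ip_linear_simps EE q_def)
    finally show ?thesis .
  qed
  have tri: "2 * (\<Sum>i\<in>?I. \<Sum>j\<in>{i<..?n}. sectional_curvature g y (e i) (e j)) = 2 * (N - 1) * Q - X"
  proof -
    have "(\<Sum>i\<in>?I. \<Sum>j\<in>{i<..?n}. sectional_curvature g y (e i) (e j)) = (\<Sum>i\<in>?I. \<Sum>j\<in>{i<..?n}. q i + q j + T i j)"
      by (intro sum.cong refl sec) auto
    also have "2 * \<dots> = (\<Sum>i\<in>?I. \<Sum>j\<in>?I. q i + q j + T i j) - (\<Sum>i\<in>?I. q i + q i + T i i)"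
      by (rule sum_upper_triangle) (simp add: T_def a_sym mult.commute)
    also have "(\<Sum>i\<in>?I. q i + q i + T i i) = 2 * Q"
      by (simp add: T_def Q_def sum.distrib power2_eq_square sum_distrib_left)
    also have "(\<Sum>i\<in>?I. \<Sum>j\<in>?I. q i + q j + T i j) = 2 * N * Q + (\<Sum>i\<in>?I. \<Sum>j\<in>?I. T i j)"
      by (simp add: sum.distrib Q_def N_def sum_distrib_left mult_ac)
    also have "(\<Sum>i\<in>?I. \<Sum>j\<in>?I. T i j) = (\<Sum>r\<in>?J. (\<Sum>i\<in>?I. a r i i) * (\<Sum>j\<in>?I. a r j j)) - X"
    proof -
      have "(\<Sum>i\<in>?I. \<Sum>j\<in>?I. T i j) = (\<Sum>r\<in>?J. \<Sum>i\<in>?I. \<Sum>j\<in>?I. a r i i * a r j j - (a r i j)\<^sup>2)"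
        unfolding T_def by (simp only: sum.swap[of _ ?J])
      then show ?thesis unfolding X_def by (simp only: sum_product sum_subtractf)
    qed
    finally show ?thesis unfolding trace0 by (simp add: algebra_simps)
  qed
  define C where "C r s i j = (\<Sum>k\<in>?I. a r i k * a s k j) - (\<Sum>k\<in>?I. a s i k * a r k j)" for r s i j
  have nc: "normal_curvature G F y (e i) (e j) (\<upsilon> r) (\<upsilon> s) = - C r s i j"
    if ij: "i \<in> ?I" "j \<in> ?I" and rs: "r \<in> ?J" "s \<in> ?J" for i j r s
  proof -
    have "normal_curvature G F y (e i) (e j) (\<upsilon> r) (\<upsilon> s) =
        ip ?A (curvature G (F y) (?e i) (?e j) (\<upsilon> r y)) (\<upsilon> s y)
        + (\<Sum>k\<in>?I. a r j k * a s i k) - (\<Sum>k\<in>?I. a r i k * a s j k)"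
      unfolding a_def
      by (rule ricci_equation[OF open_D y order_refl \<upsilon>[OF rs(1)] \<upsilon>[OF rs(2)] \<upsilon>_normal[OF _ rs(1)] \<upsilon>_normal[OF _ rs(2)] e])
    \<comment> \<open>Every summand of the Schouten form contains the inner product of a tangent
      vector with a normal one.\<close>
    also have "ip ?A (curvature G (F y) (?e i) (?e j) (\<upsilon> r y)) (\<upsilon> s y) = 0"
      unfolding R using rs by (simp add: ip_linear_simps \<upsilon>_normal')
    finally show ?thesis by (simp add: C_def a_sym[of _ _ j] mult.commute)
  qed
  have C_skew: "(C r s i j)\<^sup>2 = (C s r i j)\<^sup>2" "(C r s i j)\<^sup>2 = (C r s j i)\<^sup>2" for r s i j
    by (auto simp: C_def power2_commute a_sym[of _ _ i] a_sym[of _ _ j] mult.commute)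
  \<comment> \<open>Passing from increasing pairs to all pairs gives a factor 2 in the tangent
    indices and another in the normal ones; the diagonals vanish.\<close>
  have perp: "4 * (\<Sum>i\<in>?I. \<Sum>j\<in>{i<..?n}. \<Sum>r\<in>?J. \<Sum>s\<in>{r<..?m - ?n}. (normal_curvature G F y (e i) (e j) (\<upsilon> r) (\<upsilon> s))\<^sup>2)
     = (\<Sum>r\<in>?J. \<Sum>s\<in>?J. \<Sum>i\<in>?I. \<Sum>j\<in>?I. (C r s i j)\<^sup>2)"
  proof -
    let ?K = "\<lambda>i j. \<Sum>r\<in>?J. \<Sum>s\<in>{r<..?m - ?n}. (C r s i j)\<^sup>2"
    have diag: "C r r i j = 0" "(C r s i i)\<^sup>2 = 0" for r s i j
      by (auto simp: C_def a_sym[of _ _ i] mult.commute)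
    have Ksym: "?K i j = ?K j i" for i j
      by (rule sum.cong[OF refl], rule sum.cong[OF refl], rule C_skew(2))
    have K: "2 * ?K i j = (\<Sum>r\<in>?J. \<Sum>s\<in>?J. (C r s i j)\<^sup>2)" for i j
      by (subst sum_upper_triangle) (simp_all add: C_skew(1) diag)
    have 1: "(\<Sum>i\<in>?I. \<Sum>j\<in>{i<..?n}. \<Sum>r\<in>?J. \<Sum>s\<in>{r<..?m - ?n}. (normal_curvature G F y (e i) (e j) (\<upsilon> r) (\<upsilon> s))\<^sup>2)
       = (\<Sum>i\<in>?I. \<Sum>j\<in>{i<..?n}. ?K i j)"
      by (intro sum.cong refl) (simp add: nc)
    have 2: "2 * (\<Sum>i\<in>?I. \<Sum>j\<in>{i<..?n}. ?K i j) = (\<Sum>i\<in>?I. \<Sum>j\<in>?I. ?K i j) - (\<Sum>i\<in>?I. ?K i i)"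
      by (rule sum_upper_triangle[of ?n ?K, OF Ksym])
    have 3: "(\<Sum>i\<in>?I. ?K i i) = 0" unfolding diag by (simp only: sum.neutral_const)
    have "2 * (\<Sum>i\<in>?I. \<Sum>j\<in>?I. ?K i j) = (\<Sum>i\<in>?I. \<Sum>j\<in>?I. 2 * ?K i j)"
      by (rule trans[OF sum_distrib_left sum.cong[OF refl sum_distrib_left]])
    also have "\<dots> = (\<Sum>i\<in>?I. \<Sum>j\<in>?I. \<Sum>r\<in>?J. \<Sum>s\<in>?J. (C r s i j)\<^sup>2)" unfolding K ..
    also have "\<dots> = (\<Sum>r\<in>?J. \<Sum>s\<in>?J. \<Sum>i\<in>?I. \<Sum>j\<in>?I. (C r s i j)\<^sup>2)" by (rule sum_swap_pairs)
    finally show ?thesis using 1 2 3 by linarith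
  qed
  have "4 * (\<Sum>i\<in>?I. \<Sum>j\<in>{i<..?n}. \<Sum>r\<in>?J. \<Sum>s\<in>{r<..?m - ?n}. (normal_curvature G F y (e i) (e j) (\<upsilon> r) (\<upsilon> s))\<^sup>2) \<le> X\<^sup>2"
    unfolding perp C_def X_def by (rule ddvv_inequality_nat) (simp_all add: a_sym)
  then have "sqrt (\<Sum>i\<in>?I. \<Sum>j\<in>{i<..?n}. \<Sum>r\<in>?J. \<Sum>s\<in>{r<..?m - ?n}. (normal_curvature G F y (e i) (e j) (\<upsilon> r) (\<upsilon> s))\<^sup>2) \<le> X / 2"
    using X0 by (intro real_le_lsqrt) (auto simp: power_divide)
  then have "normalized_normal_scalar_curvature G F y e \<upsilon> \<le> 2 / (N * (N - 1)) * (X / 2)"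
    unfolding normalized_normal_scalar_curvature_def N_def[symmetric] using NM by (intro mult_left_mono) auto
  moreover have "normalized_scalar_curvature g y e = 2 / (N * (N - 1)) * ((N - 1) * Q - X / 2)"
    unfolding normalized_scalar_curvature_def N_def[symmetric] using tri by simp
  moreover have "2 / (N * (N - 1)) * ((N - 1) * Q - X / 2) + 2 / (N * (N - 1)) * (X / 2) = 2 / N * Q"
  proof -
    have "2 / (N * (N - 1)) * ((N - 1) * Q - X / 2) + 2 / (N * (N - 1)) * (X / 2) = 2 / (N * (N - 1)) * ((N - 1) * Q)"
      by (simp only: distrib_left[symmetric] diff_add_cancel)
    then show ?thesis using NM by simp
  qed
  moreover have "2 / (N * (M - 2)) * (\<Sum>j\<in>?I. ricci G (F y) (?e j) (?e j))
          - 2 * half_scalar_curvature G (F y) / ((M - 1) * (M - 2)) = 2 / N * Q"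
  proof -
    \<comment> \<open>The trace of \<open>S\<close> enters the Ricci sum and the scalar curvature
      term with the same coefficient \<open>2 / (M - 2)\<close>, so it cancels.\<close>
    define t where "t = (\<Sum>i\<in>UNIV. S (axis i 1) $ i)"
    have "(\<Sum>j\<in>?I. ricci G (F y) (?e j) (?e j)) = (\<Sum>j\<in>?I. (M - 2) * q j + t)"
      by (intro sum.cong refl) (simp add: ricci_schouten[OF S] EE q_def t_def M_def)
    also have "\<dots> = (M - 2) * Q + N * t" by (simp add: sum.distrib sum_distrib_left Q_def N_def)
    finally have ric: "(\<Sum>j\<in>?I. ricci G (F y) (?e j) (?e j)) = (M - 2) * Q + N * t" .
    have "2 / (N * (M - 2)) * ((M - 2) * Q + N * t) = 2 / N * Q + 2 * t / (M - 2)"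
      using NM by (simp add: distrib_left)
    moreover have "2 * ((M - 1) * t) / ((M - 1) * (M - 2)) = 2 * t / (M - 2)"
      using NM by simp
    ultimately show ?thesis
      unfolding ric half_scalar_schouten[OF S spd] t_def[symmetric] M_def[symmetric] by simp
  qed
  ultimately show ?thesis unfolding N_def M_def by linarith
qed

end

section \<open>From charts to coordinate domains\<close>

lemma is_chart_inverse: "is_chart c \<Longrightarrow> p \<in> fst c \<Longrightarrow> chart_inv c (snd c p) = p"
  unfolding is_chart_def by (meson homeomorphism_apply1)

lemma is_chart_open_image:
  assumes "is_chart c" "open U" shows "open (snd c ` (fst c \<inter> U))"
proof -
  have "openin (top_of_set (snd c ` fst c)) (snd c ` (fst c \<inter> U))"
    using assms by (intro homeomorphism_imp_open_map[of "fst c" _ _ "chart_inv c"]) (auto simp: is_chart_def)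
  then show ?thesis using assms openin_open_trans by (auto simp: is_chart_def)
qed

theorem corollary3p5:
  fixes M :: "('p::{t2_space, second_countable_topology}, 'n::finite) chart set"
    and N :: "('q::{t2_space, second_countable_topology}, 'm::finite) chart set"
    and G :: "('q, 'm) chart \<Rightarrow> 'm metric"
    and f :: "'p \<Rightarrow> 'q"
    and c :: "('p, 'n) chart" and d :: "('q, 'm) chart" and x :: 'p
    and F :: "real ^ 'n \<Rightarrow> real ^ 'm" and y :: "real ^ 'n"
    and e :: "nat \<Rightarrow> real ^ 'n" and \<upsilon> :: "nat \<Rightarrow> real ^ 'n \<Rightarrow> real ^ 'm"
  assumes n: "CARD('n) \<ge> 3" and m: "CARD('m) \<ge> 4"
    and ambient: "smooth_atlas N" "riemannian_metric N G" "conformally_flat N G"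
    and submanifold: "smooth_atlas M" "immersion M N f"
    and charts: "c \<in> M" "x \<in> fst c" "d \<in> N" "f x \<in> fst d"
    and coords: "y = snd c x" "F = coord_rep c d f"
    and tangent_frame: "orthonormal_family (induced_metric (G d) F y) (CARD('n)) e"
    and normal_frame: "local_normal_frame (coord_dom c d f) (G d) F y \<upsilon>"
    and ineq: "normalized_scalar_curvature (induced_metric (G d) F) y e
          + normalized_normal_scalar_curvature (G d) F y e \<upsilon>
        > 2 / (real CARD('n) * (real CARD('m) - 2)) *
            (\<Sum>j\<in>{1..CARD('n)}. ricci (G d) (F y)
               (frechet_derivative F (at y) (e j)) (frechet_derivative F (at y) (e j)))
          - 2 * half_scalar_curvature (G d) (F y) / ((real CARD('m) - 1) * (real CARD('m) - 2))"
  shows "\<not> minimal_at (G d) F y"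
proof
  assume minimal: "minimal_at (G d) F y"
  have chart: "is_chart c" "is_chart d" using ambient(1) submanifold(1) charts by (auto simp: smooth_atlas_def)
  have "f x \<in> points N" using charts by (auto simp: points_def)
  with ambient(3) obtain U u where U: "open U" "f x \<in> U"
    and "\<forall>c\<in>N. smooth_on (snd c ` (fst c \<inter> U)) (u \<circ> chart_inv c) \<and>
           (\<forall>y\<in>snd c ` (fst c \<inter> U). \<forall>v w z. curvature (\<lambda>y. exp (2 * u (chart_inv c y)) *\<^sub>R G c y) y v w z = 0)"
    unfolding conformally_flat_def by meson
  define V where "V = snd d ` (fst d \<inter> U)"
  define \<phi> where "\<phi> = u \<circ> chart_inv d"
  have \<phi>: "smooth_on V \<phi>" and flat: "\<And>y v w z. y \<in> V \<Longrightarrow> curvature (\<lambda>y. exp (2 * \<phi> y) *\<^sub>R G d y) y v w z = 0"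
    using \<open>\<forall>c\<in>N. _ c\<close> charts(3) by (auto simp: V_def \<phi>_def o_def)
  have V: "open V" "V \<subseteq> snd d ` fst d"
    unfolding V_def using is_chart_open_image[OF chart(2) U(1)] by auto
  have Gd: "smooth_on V (G d)" "\<And>z. z \<in> V \<Longrightarrow> spd (G d z)"
    using ambient(2) charts(3) V(2) smooth_on_subset[OF _ V(2)] unfolding riemannian_metric_def spd_def by blast+
  obtain W where W: "open W" "y \<in> W" "W \<subseteq> coord_dom c d f"
    and \<upsilon>: "\<And>r. r \<in> {1..CARD('m) - CARD('n)} \<Longrightarrow> smooth_on W (\<upsilon> r)"
    and \<upsilon>_on: "\<And>z. z \<in> W \<Longrightarrow> orthonormal_family (G d (F z)) (CARD('m) - CARD('n)) (\<lambda>r. \<upsilon> r z)"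
    and \<upsilon>_normal: "\<And>z r v. z \<in> W \<Longrightarrow> r \<in> {1..CARD('m) - CARD('n)} \<Longrightarrow> ip (G d (F z)) (\<upsilon> r z) (dd F z v) = 0"
    using normal_frame unfolding local_normal_frame_def by blast
  have F: "smooth_on (coord_dom c d f) F" "\<And>z. z \<in> coord_dom c d f \<Longrightarrow> inj (dd F z)"
    using submanifold(2) charts coords(2) by (auto simp: immersion_def)
  \<comment> \<open>Small enough for the normal frame to be smooth on \<open>D\<close> and for the
    image of \<open>D\<close> to lie where the conformal factor is defined.\<close>
  define D where "D = W \<inter> F -` V"
  have D: "open D" "D \<subseteq> W"
    using continuous_open_preimage[OF smooth_on_continuous[OF smooth_on_subset[OF F(1) W(3)]] W(1) V(1)]
    by (auto simp: D_def)
  have "F y = snd d (f x)"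
    using is_chart_inverse[OF chart(1) charts(2)] by (simp add: coords coord_rep_def)
  then have y: "y \<in> D" using W(2) charts(4) U(2) by (auto simp: D_def V_def)
  interpret immersed V "G d" D F
  proof
    show "smooth_on D F" using F(1) D(2) W(3) smooth_on_subset by blast
  qed (use V(1) Gd D F(2) W(3) smooth_on_differentiable[OF Gd(1)] smooth_on_differentiable[OF smooth_on_dd[OF Gd(1)]]
      in \<open>auto simp: D_def\<close>)
  obtain S where S: "schouten_form (G d (F y)) S (curvature (G d) (F y))"
    using schouten_form_conformally_flat[OF F_into[OF y] \<phi> flat[OF F_into[OF y]]] by blast
  have "smooth_on D (\<upsilon> r)" if "r \<in> {1..CARD('m) - CARD('n)}" for r
    using \<upsilon>[OF that] D(2) smooth_on_subset by blast
  from minimal_scalar_curvature_bound[OF y S _ _ tangent_frame this \<upsilon>_on[OF W(2)] \<upsilon>_normal minimal]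
  show False using ineq n m D(2) by fastforce
qed

end
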